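(* The normed space $\tilde{W}^{1,1}(\mathbb{R}^2)$, i.e. the space $W^{1,1}(\mathbb{R}^2)$ equipped with the norm $\|f\|_{\tilde{W}^{1,1}} = \|\nabla f\|_{L^1(\mathbb{R}^2;\mathbb{R}^2)}$, has the Daugavet property.
   Context: Functions are real-valued, and functions that agree almost everywhere are identified. $W^{1,1}(\mathbb{R}^2)$ is the real vector space of all $f \in L^1(\mathbb{R}^2)$ for which there exists a vector field $\nabla f \in L^1(\mathbb{R}^2;\mathbb{R}^2)$ (the weak gradient) satisfying $$\int_{\mathbb{R}^2} f \, \operatorname{div} \varphi \, dx = - \int_{\mathbb{R}^2} \nabla f \cdot \varphi \, dx$$ for every test function $\varphi \in C_c^1(\mathbb{R}^2;\mathbb{R}^2)$. Here $\|\nabla f\|_{L^1(\mathbb{R}^2;\mathbb{R}^2)} = \int_{\mathbb{R}^2} |\nabla f(x)|\,dx$, with $|\cdot|$ the Euclidean norm on $\mathbb{R}^2$. $\tilde{W}^{1,1}(\mathbb{R}^2)$ denotes $W^{1,1}(\mathbb{R}^2)$ endowed with $\|f\|_{\tilde{W}^{1,1}} := \|\nabla f\|_{L^1(\mathbb{R}^2;\mathbb{R}^2)}$, where functions in $W^{1,1}(\mathbb{R}^2)$ with vanishing gradient are factored out (on $\mathbb{R}^2$ only the zero function in $L^1$ has vanishing gradient, so the quotient is trivial). This normed space is not assumed to be complete. A normed space $X$ has the Daugavet property if $\|\mathrm{Id} + T\| = 1 + \|T\|$ for every rank-one (bounded linear) operator $T \colon X \to X$, where $\|\cdot\|$ is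 the operator norm and $\mathrm{Id}$ is the identity on $X$. *)

theory Defs
  imports "HOL-Analysis.Analysis"
begin

section \<open>The Daugavet property\<close>

text \<open>A bounded linear \<open>T\<close> has rank one iff its range is one-dimensional; note that the
  library's \<open>dim\<close> is 0 (not 1) for infinite-dimensional subspaces.\<close>

definition daugavet_property :: "'a::real_normed_vector itself \<Rightarrow> bool" where
  "daugavet_property (_ :: 'a itself) \<longleftrightarrow>
     (\<forall>T :: 'a \<Rightarrow> 'a. bounded_linear T \<and> dim (range T) = 1 \<longrightarrow>
        onorm (\<lambda>x. x + T x) = 1 + onorm T)"

section \<open>Weak gradients\<close>

definition test_field :: "('a::euclidean_space \<Rightarrow> 'a) \<Rightarrow> bool" where
  "test_field \<phi> \<longleftrightarrow>
     (\<exists>D :: 'a \<Rightarrow> 'a \<Rightarrow>\<^sub>L 'a. continuous_on UNIV D \<and>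
        (\<forall>x. (\<phi> has_derivative blinfun_apply (D x)) (at x))) \<and>
     compact (closure {x. \<phi> x \<noteq> 0})"

definition divergence :: "('a::euclidean_space \<Rightarrow> 'a) \<Rightarrow> 'a \<Rightarrow> real" where
  "divergence \<phi> x = (\<Sum>b\<in>Basis. frechet_derivative \<phi> (at x) b \<bullet> b)"

text \<open>\<open>L\<^sup>1\<close> is rendered by Borel measurable integrable functions; every Lebesgue integrable
  function agrees almost everywhere with such a function.\<close>

definition has_weak_gradient ::
    "('a::euclidean_space \<Rightarrow> real) \<Rightarrow> ('a \<Rightarrow> 'a) \<Rightarrow> bool" where
  "has_weak_gradient f g \<longleftrightarrow> integrable lborel f \<and> integrable lborel g \<and>
     (\<forall>\<phi>. test_field \<phi> \<longrightarrow>
        (LINT x|lborel. f x * divergence \<phi> x) = - (LINT x|lborel. g x \<bullet> \<phi> x))"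

definition W11 :: "('a::euclidean_space \<Rightarrow> real) set" where
  "W11 = {f. \<exists>g. has_weak_gradient f g}"

definition weak_gradient :: "('a::euclidean_space \<Rightarrow> real) \<Rightarrow> 'a \<Rightarrow> 'a" where
  "weak_gradient f = (SOME g. has_weak_gradient f g)"

subsection \<open>Linearity\<close>

lemma bounded_if_continuous_compact_support:
  fixes h :: "'a::euclidean_space \<Rightarrow> 'b::real_normed_vector"
  assumes "continuous_on UNIV h" "compact K" "\<And>x. x \<notin> K \<Longrightarrow> h x = 0"
  obtains B where "B \<ge> 0" "\<And>x. norm (h x) \<le> B"
proof -
  have "compact (h ` K)"
    using assms(1,2) by (meson compact_continuous_image continuous_on_subset subset_UNIV)
  then obtain B where B: "B > 0" "\<forall>y\<in>h ` K. norm y \<le> B"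
    using compact_imp_bounded bounded_pos by blast
  have "norm (h x) \<le> B" for x
    using B assms(3)[of x] by (cases "x \<in> K") auto
  with B(1) show ?thesis by (intro that[of B]) auto
qed

lemma test_field_continuous: "test_field \<phi> \<Longrightarrow> continuous_on UNIV \<phi>"
  unfolding test_field_def
  by (meson continuous_at_imp_continuous_on has_derivative_continuous)

lemma test_field_bounded:
  assumes "test_field \<phi>"
  obtains B where "B \<ge> 0" "\<And>x. norm (\<phi> x) \<le> B"
proof (rule bounded_if_continuous_compact_support)
  show "continuous_on UNIV \<phi>" by (rule test_field_continuous) fact
  show "compact (closure {x. \<phi> x \<noteq> 0})" using assms by (simp add: test_field_def)
  show "\<phi> x = 0" if "x \<notin> closure {x. \<phi> x \<noteq> 0}" for x
    using that closure_subset[of "{x. \<phi> x \<noteq> 0}"] by auto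
qed (use that in auto)

lemma divergence_eq:
  assumes "(\<phi> has_derivative D) (at x)"
  shows "divergence \<phi> x = (\<Sum>b\<in>Basis. D b \<bullet> b)"
  using frechet_derivative_at[OF assms] by (simp add: divergence_def)

lemma test_field_divergence_continuous:
  assumes "test_field \<phi>" shows "continuous_on UNIV (divergence \<phi>)"
proof -
  obtain D :: "'a \<Rightarrow> 'a \<Rightarrow>\<^sub>L 'a" where D: "continuous_on UNIV D"
    "\<And>x. (\<phi> has_derivative blinfun_apply (D x)) (at x)"
    using assms unfolding test_field_def by blast
  have "divergence \<phi> = (\<lambda>x. \<Sum>b\<in>Basis. D x b \<bullet> b)"
    using divergence_eq[OF D(2)] by auto
  then show ?thesis using D(1) by (auto intro!: continuous_intros)
qed

lemma test_field_divergence_bounded: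
  assumes "test_field \<phi>"
  obtains B where "B \<ge> 0" "\<And>x. norm (divergence \<phi> x) \<le> B"
proof (rule bounded_if_continuous_compact_support)
  let ?K = "closure {x. \<phi> x \<noteq> 0}"
  show "continuous_on UNIV (divergence \<phi>)" by (rule test_field_divergence_continuous) fact
  show "compact ?K" using assms by (simp add: test_field_def)
  show "divergence \<phi> x = 0" if "x \<notin> ?K" for x
  proof -
    have "(\<phi> has_derivative (\<lambda>h. 0)) (at x)"
    proof (rule has_derivative_transform_within_open)
      show "((\<lambda>_. 0) has_derivative (\<lambda>h. 0)) (at x)" by simp
      show "open (- ?K)" "x \<in> - ?K" using that by auto
      show "0 = \<phi> y" if "y \<in> - ?K" for y using that closure_subset[of "{x. \<phi> x \<noteq> 0}"] by auto
    qed
    from divergence_eq[OF this] show ?thesis by simp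
  qed
qed (use that in auto)

lemma integrable_mult_divergence:
  assumes "integrable lborel f" "test_field \<phi>"
  shows "integrable lborel (\<lambda>x. f x * divergence \<phi> x)"
proof -
  obtain B where B: "B \<ge> 0" "\<And>x. norm (divergence \<phi> x) \<le> B"
    using test_field_divergence_bounded[OF assms(2)] by blast
  have [measurable]: "divergence \<phi> \<in> borel_measurable borel"
    by (rule borel_measurable_continuous_onI, rule test_field_divergence_continuous) fact
  have [measurable]: "f \<in> borel_measurable borel" using assms(1) by auto
  show ?thesis
  proof (rule Bochner_Integration.integrable_bound)
    show "integrable lborel (\<lambda>x. B * f x)" using assms(1) by simp
    show "AE x in lborel. norm (f x * divergence \<phi> x) \<le> norm (B * f x)"
      using B by (auto simp: abs_mult mult.commute[of B] intro!: mult_left_mono)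
  qed measurable
qed

lemma integrable_inner_test_field:
  assumes "integrable lborel g" "test_field \<phi>"
  shows "integrable lborel (\<lambda>x. g x \<bullet> \<phi> x)"
proof -
  obtain B where B: "B \<ge> 0" "\<And>x. norm (\<phi> x) \<le> B"
    using test_field_bounded[OF assms(2)] by blast
  have [measurable]: "\<phi> \<in> borel_measurable borel"
    by (rule borel_measurable_continuous_onI, rule test_field_continuous) fact
  have [measurable]: "g \<in> borel_measurable borel" using assms(1) by auto
  show ?thesis
  proof (rule Bochner_Integration.integrable_bound)
    show "integrable lborel (\<lambda>x. B *\<^sub>R g x)" using assms(1) by simp
    show "AE x in lborel. norm (g x \<bullet> \<phi> x) \<le> norm (B *\<^sub>R g x)"
    proof (rule AE_I2)
      fix x
      have "\<bar>g x \<bullet> \<phi> x\<bar> \<le> norm (g x) * norm (\<phi> x)" by (rule Cauchy_Schwarz_ineq2)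
      also have "\<dots> \<le> norm (g x) * B" using B by (intro mult_left_mono) auto
      finally show "norm (g x \<bullet> \<phi> x) \<le> norm (B *\<^sub>R g x)" using B by (simp add: mult.commute)
    qed
  qed measurable
qed

lemma has_weak_gradient_zero: "has_weak_gradient (\<lambda>x. 0) (\<lambda>x. 0)"
  by (simp add: has_weak_gradient_def)

lemma has_weak_gradient_add:
  assumes "has_weak_gradient f g" "has_weak_gradient f' g'"
  shows "has_weak_gradient (\<lambda>x. f x + f' x) (\<lambda>x. g x + g' x)"
  using assms
  by (auto simp: has_weak_gradient_def algebra_simps inner_add_left
      integrable_mult_divergence integrable_inner_test_field)

lemma has_weak_gradient_scale:
  assumes "has_weak_gradient f g"
  shows "has_weak_gradient (\<lambda>x. c * f x) (\<lambda>x. c *\<^sub>R g x)"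
  using assms by (auto simp: has_weak_gradient_def mult.assoc)

lemma has_weak_gradient_uminus:
  "has_weak_gradient f g \<Longrightarrow> has_weak_gradient (\<lambda>x. - f x) (\<lambda>x. - g x)"
  using has_weak_gradient_scale[of f g "-1"] by simp

lemma has_weak_gradient_diff:
  assumes "has_weak_gradient f g" "has_weak_gradient f' g'"
  shows "has_weak_gradient (\<lambda>x. f x - f' x) (\<lambda>x. g x - g' x)"
  using has_weak_gradient_add[OF assms(1) has_weak_gradient_uminus[OF assms(2)]] by simp

lemma has_weak_gradient_cong_AE:
  assumes "has_weak_gradient f g"
    and [measurable]: "f' \<in> borel_measurable borel" "g' \<in> borel_measurable borel"
    and f': "AE x in lborel. f x = f' x" and g': "AE x in lborel. g x = g' x"
  shows "has_weak_gradient f' g'"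
proof -
  have [measurable]: "f \<in> borel_measurable borel" "g \<in> borel_measurable borel"
    using assms(1) by (auto simp: has_weak_gradient_def)
  have "integrable lborel f'" "integrable lborel g'"
    using assms(1) integrable_cong_AE[of f lborel f'] integrable_cong_AE[of g lborel g'] f' g'
    by (auto simp: has_weak_gradient_def)
  moreover have "(LINT x|lborel. f' x * divergence \<phi> x) = - (LINT x|lborel. g' x \<bullet> \<phi> x)"
    if \<phi>: "test_field \<phi>" for \<phi>
  proof -
    have [measurable]: "divergence \<phi> \<in> borel_measurable borel" "\<phi> \<in> borel_measurable borel"
      by (intro borel_measurable_continuous_onI test_field_divergence_continuous
          test_field_continuous \<phi>)+
    have "(LINT x|lborel. f' x * divergence \<phi> x) = (LINT x|lborel. f x * divergence \<phi> x)"
      by (rule integral_cong_AE) (use f' in auto)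
    also have "\<dots> = - (LINT x|lborel. g x \<bullet> \<phi> x)"
      using assms(1) \<phi> by (simp add: has_weak_gradient_def)
    also have "(LINT x|lborel. g x \<bullet> \<phi> x) = (LINT x|lborel. g' x \<bullet> \<phi> x)"
      by (rule integral_cong_AE) (use g' in auto)
    finally show ?thesis .
  qed
  ultimately show ?thesis by (simp add: has_weak_gradient_def)
qed

subsection \<open>Uniqueness\<close>

definition C1_scalar :: "('a::euclidean_space \<Rightarrow> real) \<Rightarrow> bool" where
  "C1_scalar u \<longleftrightarrow> (\<exists>G. continuous_on UNIV G \<and>
     (\<forall>x. (u has_derivative (\<lambda>h. G x \<bullet> h)) (at x)))"

lemma C1_scalar_continuous: "C1_scalar u \<Longrightarrow> continuous_on UNIV u"
  unfolding C1_scalar_def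
  by (meson continuous_at_imp_continuous_on has_derivative_continuous)

lemma C1_scalar_const: "C1_scalar (\<lambda>x. c)"
  unfolding C1_scalar_def
proof (intro exI conjI allI)
  show "((\<lambda>x. c) has_derivative (\<lambda>h. 0 \<bullet> h)) (at x)" for x
    unfolding inner_zero_left by (rule has_derivative_const)
qed simp

lemma C1_scalar_mult:
  assumes "C1_scalar u" "C1_scalar v" shows "C1_scalar (\<lambda>x. u x * v x)"
proof -
  obtain G H where *: "continuous_on UNIV G" "\<And>x. (u has_derivative (\<lambda>h. G x \<bullet> h)) (at x)"
    "continuous_on UNIV H" "\<And>x. (v has_derivative (\<lambda>h. H x \<bullet> h)) (at x)"
    using assms unfolding C1_scalar_def by blast
  show ?thesis unfolding C1_scalar_def
  proof (intro exI conjI allI)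
    show "continuous_on UNIV (\<lambda>x. v x *\<^sub>R G x + u x *\<^sub>R H x)"
      using assms * by (intro continuous_intros C1_scalar_continuous)
    show "((\<lambda>x. u x * v x) has_derivative (\<lambda>h. (v x *\<^sub>R G x + u x *\<^sub>R H x) \<bullet> h)) (at x)" for x
      by (rule derivative_eq_intros *)+ (auto simp: inner_add_left algebra_simps)
  qed
qed

lemma C1_scalar_prod:
  assumes "\<And>i. i \<in> I \<Longrightarrow> C1_scalar (u i)"
  shows "C1_scalar (\<lambda>x. \<Prod>i\<in>I. u i x)"
  using assms
  by (induction I rule: infinite_finite_induct) (auto simp: C1_scalar_const C1_scalar_mult)

lemma C1_scalar_compose:
  fixes k k' :: "real \<Rightarrow> real"
  assumes "C1_scalar u" and k: "\<And>x. (k has_real_derivative k' (u x)) (at (u x))"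
    and "continuous_on (range u) k'"
  shows "C1_scalar (\<lambda>x. k (u x))"
proof -
  obtain G where *: "continuous_on UNIV G" "\<And>x. (u has_derivative (\<lambda>h. G x \<bullet> h)) (at x)"
    using assms(1) unfolding C1_scalar_def by blast
  show ?thesis unfolding C1_scalar_def
  proof (intro exI conjI allI)
    show "continuous_on UNIV (\<lambda>x. k' (u x) *\<^sub>R G x)"
      by (rule continuous_on_scaleR[OF continuous_on_compose2[OF assms(3)
            C1_scalar_continuous[OF assms(1)] order_refl] *(1)])
    show "((\<lambda>x. k (u x)) has_derivative (\<lambda>h. (k' (u x) *\<^sub>R G x) \<bullet> h)) (at x)" for x
      using has_derivative_compose[OF *(2)[of x], of k "\<lambda>y. k' (u x) * y"] k[of x]
      by (simp add: has_field_derivative_def)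
  qed
qed

lemma C1_scalar_affine: "C1_scalar (\<lambda>x. c * (x \<bullet> b) + d)"
  unfolding C1_scalar_def
proof (intro exI conjI allI)
  show "((\<lambda>x. c * (x \<bullet> b) + d) has_derivative (\<lambda>h. (c *\<^sub>R b) \<bullet> h)) (at x)" for x
    by (auto intro!: derivative_eq_intros simp: inner_commute)
qed auto

definition pos_sq :: "real \<Rightarrow> real" where "pos_sq t = (max 0 t)\<^sup>2"

lemma pos_sq_DERIV: "(pos_sq has_real_derivative 2 * max 0 t) (at t)"
proof -
  consider "t < 0" | "t = 0" | "t > 0" by linarith
  then show ?thesis
  proof cases
    case 1
    have "((\<lambda>t. 0) has_real_derivative 0) (at t)" by simp
    then have "(pos_sq has_real_derivative 0) (at t)"
      by (rule has_field_derivative_transform_within_open[where S="{..<0}"])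
        (use 1 in \<open>simp_all add: pos_sq_def\<close>)
    then show ?thesis using 1 by simp
  next
    case 2
    have "((\<lambda>h. max 0 h) \<longlongrightarrow> max 0 (0::real)) (at 0)" by (intro tendsto_intros)
    moreover have "\<forall>\<^sub>F h in at 0. max 0 h = (pos_sq (0 + h) - pos_sq 0) / h"
      by (auto simp: eventually_at_filter pos_sq_def max_def power2_eq_square)
    ultimately have "((\<lambda>h. (pos_sq (0 + h) - pos_sq 0) / h) \<longlongrightarrow> max 0 0) (at 0)"
      by (rule Lim_transform_eventually)
    then show ?thesis using 2 by (simp add: DERIV_def)
  next
    case 3
    have "((\<lambda>t. t\<^sup>2) has_real_derivative 2 * t) (at t)" by (auto intro!: derivative_eq_intros)
    then have "(pos_sq has_real_derivative 2 * t) (at t)"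
      by (rule has_field_derivative_transform_within_open[where S="{0<..}"])
        (use 3 in \<open>simp_all add: pos_sq_def\<close>)
    then show ?thesis using 3 by simp
  qed
qed

definition bump :: "'a::euclidean_space \<Rightarrow> 'a \<Rightarrow> 'a \<Rightarrow> real" where
  "bump l u x = (\<Prod>b\<in>Basis. pos_sq (x \<bullet> b - l \<bullet> b) * pos_sq (u \<bullet> b - x \<bullet> b))"

lemma pos_sq_eq_0_iff: "pos_sq t = 0 \<longleftrightarrow> t \<le> 0"
  by (simp add: pos_sq_def max_def)

lemma bump_nonneg: "bump l u x \<ge> 0"
  unfolding bump_def by (intro prod_nonneg ballI mult_nonneg_nonneg) (simp_all add: pos_sq_def)

lemma bump_pos_iff: "bump l u x > 0 \<longleftrightarrow> x \<in> box l u"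
proof -
  have "bump l u x \<noteq> 0 \<longleftrightarrow> x \<in> box l u"
    unfolding bump_def prod_zero_iff[OF finite_Basis] mult_eq_0_iff pos_sq_eq_0_iff mem_box
    by (auto simp: not_le)
  then show ?thesis using bump_nonneg[of l u x] by linarith
qed

lemma C1_scalar_bump: "C1_scalar (bump l u)"
proof -
  have "C1_scalar (\<lambda>x. pos_sq (c * (x \<bullet> b) + d))" for c d and b :: 'a
    by (rule C1_scalar_compose[OF C1_scalar_affine pos_sq_DERIV])
      (auto intro!: continuous_intros)
  note * = this
  have "C1_scalar (\<lambda>x. pos_sq (x \<bullet> b - d))" "C1_scalar (\<lambda>x. pos_sq (d - x \<bullet> b))"
    for d and b :: 'a
    using *[of 1 b "- d"] *[of "-1" b d] by simp_all
  then show ?thesis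
    unfolding bump_def[abs_def] by (intro C1_scalar_prod C1_scalar_mult)
qed

definition box_approx :: "'a::euclidean_space \<Rightarrow> 'a \<Rightarrow> nat \<Rightarrow> 'a \<Rightarrow> real" where
  "box_approx l u n x = real n * bump l u x / (1 + real n * bump l u x)"

lemma box_approx_pos: "1 + real n * bump l u x > 0"
  using bump_nonneg[of l u x] by (simp add: add_pos_nonneg)

lemma C1_scalar_box_approx: "C1_scalar (box_approx l u n)"
proof -
  have "C1_scalar (\<lambda>x. (\<lambda>p. real n * p / (1 + real n * p)) (bump l u x))"
  proof (rule C1_scalar_compose[OF C1_scalar_bump])
    show "((\<lambda>p. real n * p / (1 + real n * p)) has_real_derivative
        (\<lambda>p. real n / (1 + real n * p)\<^sup>2) (bump l u x)) (at (bump l u x))" for x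
      using box_approx_pos[of n l u x]
      by (auto intro!: derivative_eq_intros simp: field_simps power2_eq_square)
    show "continuous_on (range (bump l u)) (\<lambda>p. real n / (1 + real n * p)\<^sup>2)"
      using box_approx_pos[of n l u] by (intro continuous_intros) (auto simp: less_le)
  qed
  then show ?thesis by (simp add: box_approx_def[abs_def])
qed

lemma box_approx_nonneg: "0 \<le> box_approx l u n x"
  unfolding box_approx_def
  using box_approx_pos[of n l u x] bump_nonneg[of l u x]
  by (intro divide_nonneg_pos mult_nonneg_nonneg) auto

lemma box_approx_le_1: "box_approx l u n x \<le> 1"
proof -
  have "real n * bump l u x \<le> 1 * (1 + real n * bump l u x)" by simp
  then show ?thesis
    unfolding box_approx_def pos_divide_le_eq[OF box_approx_pos] .
qed

lemma box_approx_outside: "x \<notin> box l u \<Longrightarrow> box_approx l u n x = 0"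
proof -
  assume "x \<notin> box l u"
  then have "bump l u x = 0"
    using bump_pos_iff[of l u x] bump_nonneg[of l u x] by linarith
  then show ?thesis by (simp add: box_approx_def)
qed

lemma box_approx_tendsto: "(\<lambda>n. box_approx l u n x) \<longlonglongrightarrow> indicator (box l u) x"
proof (cases "x \<in> box l u")
  case True
  then have p: "bump l u x > 0" by (simp add: bump_pos_iff)
  have "filterlim (\<lambda>n. bump l u x * real n) at_top sequentially"
    by (rule filterlim_tendsto_pos_mult_at_top[OF tendsto_const p filterlim_real_sequentially])
  then have "filterlim (\<lambda>n. 1 + real n * bump l u x) at_top sequentially"
    by (intro filterlim_tendsto_add_at_top[OF tendsto_const]) (simp only: mult.commute)
  then have "(\<lambda>n. 1 - inverse (1 + real n * bump l u x)) \<longlonglongrightarrow> 1 - 0"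
    by (intro tendsto_diff tendsto_const tendsto_inverse_0_at_top)
  moreover have "1 - inverse (1 + real n * bump l u x) = box_approx l u n x" for n
  proof -
    have "1 + real n * bump l u x \<noteq> 0" using box_approx_pos[of n l u x] by simp
    then show ?thesis unfolding box_approx_def by (simp add: divide_simps)
  qed
  ultimately show ?thesis using True by simp
qed (simp add: box_approx_outside)

lemma test_field_box_approx: "test_field (\<lambda>x. box_approx l u n x *\<^sub>R b)"
proof -
  obtain G where G: "continuous_on UNIV G"
    "\<And>x. (box_approx l u n has_derivative (\<lambda>h. G x \<bullet> h)) (at x)"
    using C1_scalar_box_approx unfolding C1_scalar_def by blast
  have bl: "bounded_linear (\<lambda>h. (G x \<bullet> h) *\<^sub>R b)" for x
    by (intro bounded_linear_intros)
  show ?thesis unfolding test_field_def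
  proof (intro conjI exI allI)
    show "continuous_on UNIV (\<lambda>x. Blinfun (\<lambda>h. (G x \<bullet> h) *\<^sub>R b))"
      using G(1) by (intro continuous_on_blinfun_componentwise)
        (auto simp: bounded_linear_Blinfun_apply[OF bl] intro!: continuous_intros)
    show "((\<lambda>x. box_approx l u n x *\<^sub>R b) has_derivative
        blinfun_apply (Blinfun (\<lambda>h. (G x \<bullet> h) *\<^sub>R b))) (at x)" for x
      unfolding bounded_linear_Blinfun_apply[OF bl] by (intro derivative_intros G)
    have "{x. box_approx l u n x *\<^sub>R b \<noteq> 0} \<subseteq> cbox l u"
      using box_approx_outside box_subset_cbox by fastforce
    then show "compact (closure {x. box_approx l u n x *\<^sub>R b \<noteq> 0})"
      by (meson bounded_subset bounded_cbox compact_closure)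
  qed
qed

lemma zero_if_box_integrals_zero:
  fixes g :: "'a::euclidean_space \<Rightarrow> real"
  assumes int: "integrable lborel g"
    and box: "\<And>l u. (LINT x:box l u|lborel. g x) = 0"
  shows "AE x in lborel. g x = 0"
proof -
  have si: "set_integrable lborel A g" if "A \<in> sets borel" for A
    unfolding set_integrable_def using int that by (intro integrable_mult_indicator) auto
  let ?A = "\<lambda>n::nat. box (- (real n *\<^sub>R One)) (real n *\<^sub>R One) :: 'a set"
  have univ: "(LINT x|lborel. g x) = 0"
  proof -
    have "(\<lambda>n. LINT x:?A n|lborel. g x) \<longlonglongrightarrow> (LINT x:(\<Union>n. ?A n)|lborel. g x)"
    proof (rule set_integral_cont_up)
      show "incseq ?A"
        by (intro incseq_SucI subset_box_imp) (auto simp: inner_Basis)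
    qed (auto intro: si)
    then have "(LINT x:(\<Union>n. ?A n)|lborel. g x) = 0"
      using box by (simp add: LIMSEQ_const_iff)
    then show ?thesis unfolding UN_box_eq_UNIV by (simp add: set_lebesgue_integral_def)
  qed
  have zero: "(LINT x:A|lborel. g x) = 0" if "A \<in> sets (borel :: 'a measure)" for A
  proof -
    have "A \<in> sigma_sets UNIV (range (\<lambda>(a, b). box a b :: 'a set))"
      using that by (simp add: borel_eq_box)
    note mem = this
    have subset_Pow_UNIV: "range (\<lambda>(a, b). box a b :: 'a set) \<subseteq> Pow UNIV" by simp
    have stable: "Int_stable (range (\<lambda>(a, b). box a b :: 'a set))"
      by (auto simp: Int_stable_def box_Int_box)
    show ?thesis
      using stable subset_Pow_UNIV mem
    proof (induction rule: sigma_sets_induct_disjoint)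
      case (compl A)
      then have [measurable]: "A \<in> sets borel" by (simp add: borel_eq_box)
      have "(LINT x:UNIV - A|lborel. g x) + (LINT x:A|lborel. g x) = (LINT x:(UNIV - A) \<union> A|lborel. g x)"
        by (rule set_integral_Un[symmetric]) (auto intro!: si)
      also have "\<dots> = 0" using univ by (simp add: set_lebesgue_integral_def)
      finally show ?case using compl by simp
    next
      case (union A)
      then have A: "\<And>i. A i \<in> sets borel" by (auto simp: borel_eq_box)
      have "(LINT x:(\<Union>i. A i)|lborel. g x) = (\<Sum>i. LINT x:A i|lborel. g x)"
        using union A by (intro lebesgue_integral_countable_add si) (auto simp: disjoint_family_on_def)
      then show ?case using union by simp
    qed (use box in \<open>auto simp: set_lebesgue_integral_def\<close>)
  qed
  show ?thesis
    using density_unique_real[OF int, of "\<lambda>x. 0"] zero by simp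
qed

lemma zero_if_test_integrals_zero:
  fixes g :: "'a::euclidean_space \<Rightarrow> 'a"
  assumes int: "integrable lborel g"
    and zero: "\<And>\<phi>. test_field \<phi> \<Longrightarrow> (LINT x|lborel. g x \<bullet> \<phi> x) = 0"
  shows "AE x in lborel. g x = 0"
proof -
  have [measurable]: "g \<in> borel_measurable borel" using int by auto
  have "AE x in lborel. g x \<bullet> b = 0" for b
  proof (rule zero_if_box_integrals_zero)
    show gb: "integrable lborel (\<lambda>x. g x \<bullet> b)" using int by simp
    fix l u :: 'a
    have [measurable]: "box_approx l u n \<in> borel_measurable borel" for n
      by (rule borel_measurable_continuous_onI, rule C1_scalar_continuous, rule C1_scalar_box_approx)
    have "(\<lambda>n. LINT x|lborel. box_approx l u n x *\<^sub>R (g x \<bullet> b))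
        \<longlonglongrightarrow> (LINT x|lborel. indicator (box l u) x *\<^sub>R (g x \<bullet> b))"
    proof (rule integral_dominated_convergence)
      show "integrable lborel (\<lambda>x. norm (g x \<bullet> b))" using gb by (rule integrable_norm)
      show "AE x in lborel. (\<lambda>n. box_approx l u n x *\<^sub>R (g x \<bullet> b)) \<longlonglongrightarrow> indicator (box l u) x *\<^sub>R (g x \<bullet> b)"
        by (intro AE_I2 tendsto_scaleR box_approx_tendsto tendsto_const)
      show "AE x in lborel. norm (box_approx l u n x *\<^sub>R (g x \<bullet> b)) \<le> norm (g x \<bullet> b)" for n
        using box_approx_nonneg[of l u n] box_approx_le_1[of l u n]
        by (auto simp: abs_mult intro!: mult_left_le_one_le)
    qed measurable
    moreover have "(LINT x|lborel. box_approx l u n x *\<^sub>R (g x \<bullet> b)) = 0" for n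
      using zero[OF test_field_box_approx[of l u n b]] by simp
    ultimately show "(LINT x:box l u|lborel. g x \<bullet> b) = 0"
      by (simp add: set_lebesgue_integral_def LIMSEQ_const_iff)
  qed
  then have "AE x in lborel. \<forall>b\<in>Basis. g x \<bullet> b = 0"
    by (subst AE_finite_all) auto
  then show ?thesis by (rule AE_mp) (auto simp: euclidean_all_zero_iff)
qed

lemma weak_gradient_unique:
  assumes "has_weak_gradient f g" "has_weak_gradient f g'"
  shows "AE x in lborel. g x = g' x"
proof -
  have "AE x in lborel. g x - g' x = 0"
  proof (rule zero_if_test_integrals_zero)
    show "integrable lborel (\<lambda>x. g x - g' x)" using assms by (auto simp: has_weak_gradient_def)
    show "(LINT x|lborel. (g x - g' x) \<bullet> \<phi> x) = 0" if "test_field \<phi>" for \<phi>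
      using assms that has_weak_gradient_diff[OF assms] by (simp add: has_weak_gradient_def)
  qed
  then show ?thesis by simp
qed

lemma has_weak_gradient_weak_gradient: "f \<in> W11 \<Longrightarrow> has_weak_gradient f (weak_gradient f)"
  unfolding W11_def weak_gradient_def by (simp add: someI_ex)

lemma weak_gradient_eqI:
  assumes "has_weak_gradient f g"
  shows "AE x in lborel. weak_gradient f x = g x"
  using assms has_weak_gradient_weak_gradient[of f] weak_gradient_unique
  by (auto simp: W11_def)

section \<open>The homogeneous Sobolev space of the plane\<close>

definition sobolev_norm :: "('a::euclidean_space \<Rightarrow> real) \<Rightarrow> real" where
  "sobolev_norm f = (LINT x|lborel. norm (weak_gradient f x))"

text \<open>Functions whose difference has vanishing weak gradient are identified.  This subsumes
  identification of functions that agree almost everywhere.\<close>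

definition sobolev_rel :: "('a::euclidean_space \<Rightarrow> real) \<Rightarrow> ('a \<Rightarrow> real) \<Rightarrow> bool" where
  "sobolev_rel f g \<longleftrightarrow> f \<in> W11 \<and> g \<in> W11 \<and> has_weak_gradient (\<lambda>x. f x - g x) (\<lambda>x. 0)"

lemma sobolev_rel_if_AE_eq:
  assumes "f \<in> W11" "g \<in> W11" "AE x in lborel. f x = g x"
  shows "sobolev_rel f g"
proof -
  have "f \<in> borel_measurable borel" "g \<in> borel_measurable borel"
    using assms(1,2) by (auto simp: W11_def has_weak_gradient_def)
  then have "has_weak_gradient (\<lambda>x. f x - g x) (\<lambda>x. 0)"
    using assms(3) by (intro has_weak_gradient_cong_AE[OF has_weak_gradient_zero]) auto
  with assms show ?thesis by (simp add: sobolev_rel_def)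
qed

lemma sobolev_norm_eq:
  assumes "has_weak_gradient f g"
  shows "sobolev_norm f = (LINT x|lborel. norm (g x))"
proof -
  have "has_weak_gradient f (weak_gradient f)"
    using assms has_weak_gradient_weak_gradient by (auto simp: W11_def)
  then have [measurable]: "weak_gradient f \<in> borel_measurable borel"
    by (auto simp: has_weak_gradient_def)
  have [measurable]: "g \<in> borel_measurable borel"
    using assms by (auto simp: has_weak_gradient_def)
  show ?thesis unfolding sobolev_norm_def
    by (rule integral_cong_AE) (use weak_gradient_eqI[OF assms] in auto)
qed

lemma sobolev_rel_refl: "f \<in> W11 \<Longrightarrow> sobolev_rel f f"
  by (simp add: sobolev_rel_def has_weak_gradient_zero)

lemma sobolev_rel_iff:
  assumes "has_weak_gradient f g" "has_weak_gradient f' g'"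
  shows "sobolev_rel f f' \<longleftrightarrow> (AE x in lborel. g x = g' x)"
proof
  assume "sobolev_rel f f'"
  then have "has_weak_gradient (\<lambda>x. f x - f' x) (\<lambda>x. 0)" by (simp add: sobolev_rel_def)
  with has_weak_gradient_diff[OF assms] have "AE x in lborel. g x - g' x = 0"
    by (rule weak_gradient_unique)
  then show "AE x in lborel. g x = g' x" by simp
next
  assume *: "AE x in lborel. g x = g' x"
  have [measurable]: "f \<in> borel_measurable borel" "f' \<in> borel_measurable borel"
    using assms by (auto simp: has_weak_gradient_def)
  have "has_weak_gradient (\<lambda>x. f x - f' x) (\<lambda>x. 0)"
    by (rule has_weak_gradient_cong_AE[OF has_weak_gradient_diff[OF assms]]) (use * in auto)
  then show "sobolev_rel f f'" using assms by (auto simp: sobolev_rel_def W11_def)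
qed

lemma sobolev_relE:
  assumes "sobolev_rel f f'"
  obtains g g' where "has_weak_gradient f g" "has_weak_gradient f' g'"
    "AE x in lborel. g x = g' x"
proof -
  obtain g g' where *: "has_weak_gradient f g" "has_weak_gradient f' g'"
    using assms unfolding sobolev_rel_def W11_def by blast
  with assms have "AE x in lborel. g x = g' x" using sobolev_rel_iff by blast
  with * show ?thesis by (rule that)
qed

lemma sobolev_rel_zero: "sobolev_rel (\<lambda>x. 0) (\<lambda>x. 0)"
  by (rule sobolev_rel_refl) (auto simp: W11_def intro: has_weak_gradient_zero)

lemma part_equivp_sobolev_rel:
  "part_equivp (sobolev_rel :: ('a::euclidean_space \<Rightarrow> real) \<Rightarrow> _)"
proof (rule part_equivpI)
  show "\<exists>f :: 'a \<Rightarrow> real. sobolev_rel f f" using sobolev_rel_zero by blast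
  show "symp (sobolev_rel :: ('a \<Rightarrow> real) \<Rightarrow> _)"
    by (auto simp: symp_def sobolev_rel_def dest: has_weak_gradient_uminus)
  show "transp (sobolev_rel :: ('a \<Rightarrow> real) \<Rightarrow> _)"
  proof (rule transpI)
    fix f g h :: "'a \<Rightarrow> real"
    assume *: "sobolev_rel f g" "sobolev_rel g h"
    show "sobolev_rel f h"
      using has_weak_gradient_add[of "\<lambda>x. f x - g x" "\<lambda>x. 0" "\<lambda>x. g x - h x" "\<lambda>x. 0"] *
      by (simp add: sobolev_rel_def)
  qed
qed

quotient_type sobolev = "real^2 \<Rightarrow> real" / partial: "sobolev_rel"
  by (rule part_equivp_sobolev_rel)

instantiation sobolev :: real_normed_vector
begin

lift_definition zero_sobolev :: sobolev is "\<lambda>x. 0"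
  by (rule sobolev_rel_zero)

lift_definition plus_sobolev :: "sobolev \<Rightarrow> sobolev \<Rightarrow> sobolev" is "\<lambda>f g x. f x + g x"
proof -
  fix f f' g g' :: "real^2 \<Rightarrow> real"
  assume "sobolev_rel f f'" "sobolev_rel g g'"
  then obtain F F' G G' where
    F: "has_weak_gradient f F" "has_weak_gradient f' F'" "AE x in lborel. F x = F' x" and
    G: "has_weak_gradient g G" "has_weak_gradient g' G'" "AE x in lborel. G x = G' x"
    by (blast elim: sobolev_relE)
  show "sobolev_rel (\<lambda>x. f x + g x) (\<lambda>x. f' x + g' x)"
    by (subst sobolev_rel_iff[OF has_weak_gradient_add[OF F(1) G(1)] has_weak_gradient_add[OF F(2) G(2)]])
      (use F(3) G(3) in auto)
qed

lift_definition uminus_sobolev :: "sobolev \<Rightarrow> sobolev" is "\<lambda>f x. - f x"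
proof -
  fix f f' :: "real^2 \<Rightarrow> real"
  assume "sobolev_rel f f'"
  then obtain F F' where
    F: "has_weak_gradient f F" "has_weak_gradient f' F'" "AE x in lborel. F x = F' x"
    by (rule sobolev_relE)
  show "sobolev_rel (\<lambda>x. - f x) (\<lambda>x. - f' x)"
    by (subst sobolev_rel_iff[OF has_weak_gradient_uminus[OF F(1)] has_weak_gradient_uminus[OF F(2)]])
      (use F(3) in auto)
qed

definition minus_sobolev :: "sobolev \<Rightarrow> sobolev \<Rightarrow> sobolev" where
  "minus_sobolev f g = f + (- g)"

lift_definition scaleR_sobolev :: "real \<Rightarrow> sobolev \<Rightarrow> sobolev" is "\<lambda>c f x. c * f x"
proof -
  fix c and f f' :: "real^2 \<Rightarrow> real"
  assume "sobolev_rel f f'"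
  then obtain F F' where
    F: "has_weak_gradient f F" "has_weak_gradient f' F'" "AE x in lborel. F x = F' x"
    by (rule sobolev_relE)
  show "sobolev_rel (\<lambda>x. c * f x) (\<lambda>x. c * f' x)"
    by (subst sobolev_rel_iff[OF has_weak_gradient_scale[OF F(1)] has_weak_gradient_scale[OF F(2)]])
      (use F(3) in auto)
qed

lift_definition norm_sobolev :: "sobolev \<Rightarrow> real" is sobolev_norm
proof -
  fix f f' :: "real^2 \<Rightarrow> real"
  assume "sobolev_rel f f'"
  then obtain F F' where
    F: "has_weak_gradient f F" "has_weak_gradient f' F'" "AE x in lborel. F x = F' x"
    by (rule sobolev_relE)
  have [measurable]: "F \<in> borel_measurable borel" "F' \<in> borel_measurable borel"
    using F by (auto simp: has_weak_gradient_def)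
  have "(LINT x|lborel. norm (F x)) = (LINT x|lborel. norm (F' x))"
    by (rule integral_cong_AE) (use F(3) in auto)
  then show "sobolev_norm f = sobolev_norm f'"
    using sobolev_norm_eq[OF F(1)] sobolev_norm_eq[OF F(2)] by simp
qed

definition dist_sobolev :: "sobolev \<Rightarrow> sobolev \<Rightarrow> real" where
  "dist_sobolev f g = norm (f - g)"

definition sgn_sobolev :: "sobolev \<Rightarrow> sobolev" where
  "sgn_sobolev f = inverse (norm f) *\<^sub>R f"

definition uniformity_sobolev :: "(sobolev \<times> sobolev) filter" where
  "uniformity_sobolev = (INF e\<in>{0<..}. principal {(f, g). dist f g < e})"

definition open_sobolev :: "sobolev set \<Rightarrow> bool" where
  "open_sobolev U \<longleftrightarrow> (\<forall>f\<in>U. \<forall>\<^sub>F (f', g) in uniformity. f' = f \<longrightarrow> g \<in> U)"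

instance
proof
  fix f g h :: sobolev and a b :: real
  have add_cl: "p \<in> W11 \<Longrightarrow> q \<in> W11 \<Longrightarrow> (\<lambda>x. p x + q x) \<in> W11" for p q :: "real^2 \<Rightarrow> real"
    by (auto simp: W11_def intro: has_weak_gradient_add)
  have sc_cl: "p \<in> W11 \<Longrightarrow> (\<lambda>x. c * p x) \<in> W11" for p :: "real^2 \<Rightarrow> real" and c
    by (auto simp: W11_def intro: has_weak_gradient_scale)
  have in_W11: "sobolev_rel p p \<Longrightarrow> p \<in> W11" for p :: "real^2 \<Rightarrow> real"
    by (simp add: sobolev_rel_def)
  note cl = sobolev_rel_refl add_cl sc_cl
  show "f + g + h = f + (g + h)"
    by transfer (simp only: add.assoc, intro cl; erule in_W11)
  show "f + g = g + f"
    by transfer (simp only: add.commute, intro cl; erule in_W11)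
  show "0 + f = f"
    by transfer simp
  show "- f + f = 0"
    by transfer (simp add: sobolev_rel_zero)
  show "f - g = f + - g" by (simp add: minus_sobolev_def)
  show "a *\<^sub>R (f + g) = a *\<^sub>R f + a *\<^sub>R g"
    by transfer (simp only: distrib_left, intro cl; erule in_W11)
  show "(a + b) *\<^sub>R f = a *\<^sub>R f + b *\<^sub>R f"
    by transfer (simp only: distrib_right, intro cl; erule in_W11)
  show "a *\<^sub>R b *\<^sub>R f = (a * b) *\<^sub>R f"
    by transfer (simp only: mult.assoc, intro cl; erule in_W11)
  show "1 *\<^sub>R f = f"
    by transfer simp
  show "dist f g = norm (f - g)" by (simp add: dist_sobolev_def)
  show "sgn f = inverse (norm f) *\<^sub>R f" by (simp add: sgn_sobolev_def)
  show "(uniformity :: (sobolev \<times> sobolev) filter) = (INF e\<in>{0<..}. principal {(f, g). dist f g < e})"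
    by (rule uniformity_sobolev_def)
  show "open U = (\<forall>f\<in>U. \<forall>\<^sub>F (f', g) in uniformity. f' = f \<longrightarrow> g \<in> U)" for U :: "sobolev set"
    by (rule open_sobolev_def)
  show "norm f = 0 \<longleftrightarrow> f = 0"
  proof transfer
    fix f :: "real^2 \<Rightarrow> real"
    assume "sobolev_rel f f"
    then obtain F where F: "has_weak_gradient f F" by (auto simp: sobolev_rel_def W11_def)
    then have "integrable lborel F" by (simp add: has_weak_gradient_def)
    then have "(LINT x|lborel. norm (F x)) = 0 \<longleftrightarrow> (AE x in lborel. F x = 0)"
      by (subst integral_nonneg_eq_0_iff_AE) auto
    then show "sobolev_norm f = 0 \<longleftrightarrow> sobolev_rel f (\<lambda>x. 0)"
      using sobolev_norm_eq[OF F] sobolev_rel_iff[OF F has_weak_gradient_zero] by simp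
  qed
  show "norm (f + g) \<le> norm f + norm g"
  proof transfer
    fix f g :: "real^2 \<Rightarrow> real"
    assume "sobolev_rel f f" "sobolev_rel g g"
    then obtain F G where FG: "has_weak_gradient f F" "has_weak_gradient g G"
      by (auto simp: sobolev_rel_def W11_def)
    then have int: "integrable lborel F" "integrable lborel G" by (auto simp: has_weak_gradient_def)
    have "(LINT x|lborel. norm (F x + G x)) \<le> (LINT x|lborel. norm (F x) + norm (G x))"
      using int by (intro integral_mono norm_triangle_ineq) auto
    also have "\<dots> = (LINT x|lborel. norm (F x)) + (LINT x|lborel. norm (G x))"
      using int by simp
    finally show "sobolev_norm (\<lambda>x. f x + g x) \<le> sobolev_norm f + sobolev_norm g"
      using sobolev_norm_eq[OF FG(1)] sobolev_norm_eq[OF FG(2)]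
        sobolev_norm_eq[OF has_weak_gradient_add[OF FG]] by simp
  qed
  show "norm (a *\<^sub>R f) = \<bar>a\<bar> * norm f"
  proof transfer
    fix a and f :: "real^2 \<Rightarrow> real"
    assume "sobolev_rel f f"
    then obtain F where F: "has_weak_gradient f F" by (auto simp: sobolev_rel_def W11_def)
    show "sobolev_norm (\<lambda>x. a * f x) = \<bar>a\<bar> * sobolev_norm f"
      using sobolev_norm_eq[OF F] sobolev_norm_eq[OF has_weak_gradient_scale[OF F]] by simp
  qed
qed

end

end

theory Submission
  imports Defs
begin

text \<open>
  The space is measured by the gradient in \<open>L\<^sup>1\<close>, so two of its elements are almost
  \<open>\<ell>\<^sup>1\<close>-orthogonal as soon as one of them has its gradient on a set that carries little
  of the gradient of the other.  The Daugavet property of a rank-one operator \<open>x \<mapsto> \<xi> x *\<^sub>R e\<close>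
  asks for unit vectors \<open>y\<close> that almost attain the norm of \<open>\<xi>\<close> and are in this sense almost
  orthogonal to \<open>e\<close>.

  Such a \<open>y\<close> is a normalised horizontal layer of a function.  Take \<open>x\<close> that almost attains the
  norm of \<open>\<xi>\<close>, with representative \<open>f\<close> and gradient \<open>G\<close>.  Truncating \<open>f\<close> at a level \<open>c\<close>
  multiplies the gradient by the indicator of \<open>{f \<le> c}\<close>, and \<open>G\<close> vanishes almost everywhere
  on each level set \<open>{f = c}\<close> (\<open>weak_gradient_cut_above\<close>).  The mass of \<open>|G|\<close> on \<open>{f \<le> c}\<close>
  is therefore a continuous function of \<open>c\<close>, and levels can be chosen that cut \<open>x\<close> into \<open>N\<close>
  layers of norm \<open>norm x / N\<close> whose gradients live on disjoint sets (\<open>gradient_layers\<close>,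
  \<open>sobolev_layers\<close>).  For a given \<open>\<eta>\<close> only a bounded number of these disjoint sets can carry
  more than \<open>\<eta>\<close> of the gradient of \<open>e\<close>, and the corresponding layers contribute only
  \<open>O(1 / N)\<close> to \<open>x\<close>.  Since \<open>\<xi> x\<close> is the sum of the values on the layers, for large \<open>N\<close> one of
  the remaining layers must have a ratio \<open>\<xi> y / norm y\<close> as good as that of \<open>x\<close>
  (\<open>slice_almost_l1_orthogonal\<close>).

  The truncation rule rests on the description of weak partial derivatives as
  \<open>L\<^sup>1\<close>-limits of difference quotients (\<open>weak_partial_tendsto_L1\<close> and its converse
  \<open>has_weak_partial_if_tendsto_L1\<close>).  Difference quotients of a truncation of \<open>f\<close> are
  controlled pointwise by those of \<open>f\<close>, so the chain rule needs no smoothing.  At points with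
  \<open>f x = c\<close> the one-sided limits from the two sides are \<open>min (\<partial>f) 0\<close> and
  \<open>max (\<partial>f) 0\<close>; both yield the same weak derivative, which forces \<open>\<partial>f = 0\<close> there.
\<close>

section \<open>Continuity of translations in the mean\<close>

lemma integrable_lborel_translate:
  fixes F :: "'a::euclidean_space \<Rightarrow> 'b::{banach, second_countable_topology}"
  assumes "integrable lborel F"
  shows "integrable lborel (\<lambda>x. F (x + h))"
proof -
  have "integrable (distr lborel borel ((+) h)) F"
    using assms by (simp add: lborel_distr_plus)
  then have "integrable lborel (\<lambda>x. F (h + x))"
    by (rule integrable_distr[rotated]) simp
  then show ?thesis by (simp add: add.commute)
qed

lemma integral_lborel_translate:
  fixes F :: "'a::euclidean_space \<Rightarrow> 'b::{banach, second_countable_topology}"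
  assumes [measurable]: "F \<in> borel_measurable borel"
  shows "(LINT x|lborel. F (x + h)) = (LINT x|lborel. F x)"
proof -
  have "(LINT x|lborel. F x) = (LINT x|distr lborel borel ((+) h). F x)"
    by (simp add: lborel_distr_plus)
  also have "\<dots> = (LINT x|lborel. F (h + x))"
    by (rule integral_distr) auto
  finally show ?thesis by (simp add: add.commute)
qed

text \<open>Translations are isometries of \<open>L\<^sup>1\<close>, so the functions on which they act continuously
  form a closed set.  This serves both the passage from open to Borel sets and the limit step
  of the induction over integrable functions.\<close>
lemma translate_tendsto_L1_approx:
  fixes F :: "'a::euclidean_space \<Rightarrow> 'b::{banach, second_countable_topology}"
  assumes F: "integrable lborel F"
    and approx: "\<And>e. e > 0 \<Longrightarrow> \<exists>G. integrable lborel G \<and> (LINT x|lborel. norm (F x - G x)) < e \<and>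
      (\<lambda>n. LINT x|lborel. norm (G (x + h n) - G x)) \<longlonglongrightarrow> 0"
  shows "(\<lambda>n::nat. LINT x|lborel. norm (F (x + h n) - F x)) \<longlonglongrightarrow> 0"
proof (rule LIMSEQ_I)
  fix r :: real assume "r > 0"
  then obtain G where G: "integrable lborel G" "(LINT x|lborel. norm (F x - G x)) < r / 4"
    and lim: "(\<lambda>n. LINT x|lborel. norm (G (x + h n) - G x)) \<longlonglongrightarrow> 0"
    using approx[of "r / 4"] by auto
  obtain N where N: "\<And>n. n \<ge> N \<Longrightarrow> norm ((LINT x|lborel. norm (G (x + h n) - G x)) - 0) < r / 4"
    using LIMSEQ_D[OF lim, of "r / 4"] \<open>r > 0\<close> by auto
  note tr = integrable_lborel_translate
  have [measurable]: "F \<in> borel_measurable borel" "G \<in> borel_measurable borel"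
    using F G by auto
  have "norm ((LINT x|lborel. norm (F (x + h n) - F x)) - 0) < r" if "n \<ge> N" for n
  proof -
    have "(LINT x|lborel. norm (F (x + h n) - F x))
      \<le> (LINT x|lborel. norm (F (x + h n) - G (x + h n)) + norm (G (x + h n) - G x) + norm (F x - G x))"
    proof (rule integral_mono)
      fix x
      have "F (x + h n) - F x = (F (x + h n) - G (x + h n)) + (G (x + h n) - G x) - (F x - G x)"
        by simp
      then show "norm (F (x + h n) - F x)
          \<le> norm (F (x + h n) - G (x + h n)) + norm (G (x + h n) - G x) + norm (F x - G x)"
        by (metis (no_types) norm_triangle_ineq norm_triangle_ineq4 add_right_mono order_trans)
    qed (use F G in \<open>auto intro!: tr Bochner_Integration.integrable_diff Bochner_Integration.integrable_add integrable_norm\<close>)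
    also have "\<dots> = (LINT x|lborel. norm (F (x + h n) - G (x + h n)))
        + (LINT x|lborel. norm (G (x + h n) - G x)) + (LINT x|lborel. norm (F x - G x))"
      using F G by (subst Bochner_Integration.integral_add; (subst Bochner_Integration.integral_add)?;
          auto intro!: tr Bochner_Integration.integrable_diff Bochner_Integration.integrable_add integrable_norm)
    also have "(LINT x|lborel. norm (F (x + h n) - G (x + h n))) = (LINT x|lborel. norm (F x - G x))"
      by (rule integral_lborel_translate) measurable
    finally have "(LINT x|lborel. norm (F (x + h n) - F x)) < r"
      using N[OF that] G(2) \<open>r > 0\<close> by auto
    moreover have "0 \<le> (LINT x|lborel. norm (F (x + h n) - F x))" by simp
    ultimately show ?thesis by simp
  qed
  then show "\<exists>N. \<forall>n\<ge>N. norm ((LINT x|lborel. norm (F (x + h n) - F x)) - 0) < r" by blast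
qed

text \<open>For an open set the indicators of \<open>U\<close> and of its translates agree eventually at each
  point of \<open>U\<close>; the points outside are handled by the translation invariance of the
  measure, through \<open>\<bar>a - b\<bar> = a + b - 2 * a * b\<close> for \<open>a\<close> and \<open>b\<close> in \<open>{0, 1}\<close>.\<close>
lemma translate_tendsto_L1_open:
  fixes U :: "'a::euclidean_space set"
  assumes "open U" "emeasure lborel U < \<infinity>" "h \<longlonglongrightarrow> 0"
  shows "(\<lambda>n. LINT x|lborel. norm (indicator U (x + h n) - indicator U x :: real)) \<longlonglongrightarrow> 0"
proof -
  have [measurable]: "U \<in> sets borel" using assms by simp
  have int: "integrable lborel (indicator U :: 'a \<Rightarrow> real)"
    using assms by simp
  have prod: "integrable lborel (\<lambda>x. indicator U x * indicator U (x + h n) :: real)" for n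
    by (rule Bochner_Integration.integrable_bound[OF int]) (auto simp: indicator_def)
  have "(\<lambda>n. LINT x|lborel. indicator U x * indicator U (x + h n) :: real)
      \<longlonglongrightarrow> (LINT x|lborel. indicator U x)"
  proof (rule integral_dominated_convergence[where w="indicator U"])
    show "AE x in lborel. (\<lambda>n. indicator U x * indicator U (x + h n) :: real) \<longlonglongrightarrow> indicator U x"
    proof (rule AE_I2)
      fix x
      have "eventually (\<lambda>n. indicator U x * indicator U (x + h n) = (indicator U x :: real)) sequentially"
      proof (cases "x \<in> U")
        case True
        have "(\<lambda>n. x + h n) \<longlonglongrightarrow> x"
          using tendsto_add[OF tendsto_const \<open>h \<longlonglongrightarrow> 0\<close>, of x] by simp
        then have "eventually (\<lambda>n. x + h n \<in> U) sequentially"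
          using True \<open>open U\<close> topological_tendstoD by blast
        then show ?thesis by (rule eventually_mono) (simp add: True)
      qed simp
      then show "(\<lambda>n. indicator U x * indicator U (x + h n) :: real) \<longlonglongrightarrow> indicator U x"
        by (rule tendsto_eventually)
    qed
  qed (use int in \<open>auto simp: indicator_def\<close>)
  then have "(\<lambda>n. 2 * (LINT x|lborel. indicator U x) - 2 * (LINT x|lborel. indicator U x * indicator U (x + h n) :: real))
      \<longlonglongrightarrow> 2 * (LINT x|lborel. indicator U x) - 2 * (LINT x|lborel. indicator U x)"
    by (intro tendsto_intros)
  moreover have "(LINT x|lborel. norm (indicator U (x + h n) - indicator U x :: real))
      = 2 * (LINT x|lborel. indicator U x) - 2 * (LINT x|lborel. indicator U x * indicator U (x + h n) :: real)" for n
  proof -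
    have "(LINT x|lborel. norm (indicator U (x + h n) - indicator U x :: real))
        = (LINT x|lborel. indicator U (x + h n) + indicator U x - 2 * (indicator U x * indicator U (x + h n)))"
      by (rule Bochner_Integration.integral_cong) (auto simp: indicator_def)
    also have "\<dots> = (LINT x|lborel. indicator U (x + h n)) + (LINT x|lborel. indicator U x)
        - 2 * (LINT x|lborel. indicator U x * indicator U (x + h n))"
      using int prod integrable_lborel_translate[OF int] by simp
    also have "(LINT x|lborel. indicator U (x + h n) :: real) = (LINT x|lborel. indicator U x)"
      by (rule integral_lborel_translate) measurable
    finally show ?thesis by simp
  qed
  ultimately show ?thesis by simp
qed

lemma translate_tendsto_L1_indicator:
  fixes A :: "'a::euclidean_space set"
  assumes A[measurable]: "A \<in> sets borel" and fin: "emeasure lborel A < \<infinity>" and h: "h \<longlonglongrightarrow> 0"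
  shows "(\<lambda>n. LINT x|lborel. norm (indicator A (x + h n) - indicator A x :: real)) \<longlonglongrightarrow> 0"
proof (rule translate_tendsto_L1_approx)
  show "integrable lborel (indicator A :: 'a \<Rightarrow> real)" using fin by simp
  fix e :: real assume "e > 0"
  from outer_regular_lborel[OF A \<open>e > 0\<close>] obtain U where
    U: "open U" "A \<subseteq> U" "emeasure lborel (U - A) < ennreal e" by blast
  have [measurable]: "U \<in> sets borel" using U by simp
  have dfin: "emeasure lborel (U - A) < \<infinity>" using U(3) by (rule order_less_trans) simp
  have "emeasure lborel U = emeasure lborel A + emeasure lborel (U - A)"
    using U(2) by (subst plus_emeasure) (auto intro!: arg_cong[where f="emeasure lborel"])
  also have "\<dots> < \<infinity>" using fin dfin by simp
  finally have Ufin: "emeasure lborel U < \<infinity>" .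
  have "(LINT x|lborel. norm (indicator A x - indicator U x :: real)) = (LINT x|lborel. indicator (U - A) x)"
    by (rule Bochner_Integration.integral_cong) (use U(2) in \<open>auto simp: indicator_def\<close>)
  also have "\<dots> = measure lborel (U - A)" by simp
  also have "\<dots> < e"
    using U(3) dfin \<open>e > 0\<close> by (simp add: emeasure_eq_ennreal_measure ennreal_less_iff)
  finally show "\<exists>G. integrable lborel G \<and> (LINT x|lborel. norm (indicator A x - G x)) < e \<and>
      (\<lambda>n. LINT x|lborel. norm (G (x + h n) - G x :: real)) \<longlonglongrightarrow> 0"
    using translate_tendsto_L1_open[OF U(1) Ufin h] Ufin by (intro exI[of _ "indicator U"]) auto
qed

proposition translate_tendsto_L1:
  fixes F :: "'a::euclidean_space \<Rightarrow> 'b::{banach, second_countable_topology}"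
  assumes "integrable lborel F" and h: "h \<longlonglongrightarrow> 0"
  shows "(\<lambda>n. LINT x|lborel. norm (F (x + h n) - F x)) \<longlonglongrightarrow> 0"
  using assms(1)
proof (induction F rule: integrable_induct)
  case (base A c)
  have "(\<lambda>n. (LINT x|lborel. norm (indicator A (x + h n) - indicator A x :: real)) * norm c) \<longlonglongrightarrow> 0 * norm c"
    using base h by (intro tendsto_mult_right translate_tendsto_L1_indicator) auto
  then show ?case by (simp flip: scaleR_diff_left)
next
  case (add f g)
  note tr = integrable_lborel_translate
  show ?case
  proof (rule tendsto_sandwich[OF _ _ tendsto_const])
    show "(\<lambda>n. (LINT x|lborel. norm (f (x + h n) - f x)) + (LINT x|lborel. norm (g (x + h n) - g x))) \<longlonglongrightarrow> 0"
      using tendsto_add[OF add(3,4)] by simp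
    show "\<forall>\<^sub>F n in sequentially. (LINT x|lborel. norm (f (x + h n) + g (x + h n) - (f x + g x)))
        \<le> (LINT x|lborel. norm (f (x + h n) - f x)) + (LINT x|lborel. norm (g (x + h n) - g x))"
    proof (rule always_eventually, rule allI)
      fix n
      have "(LINT x|lborel. norm (f (x + h n) + g (x + h n) - (f x + g x)))
          \<le> (LINT x|lborel. norm (f (x + h n) - f x) + norm (g (x + h n) - g x))"
        using add(1,2)
        by (intro integral_mono norm_diff_triangle_ineq)
          (auto intro!: tr Bochner_Integration.integrable_diff Bochner_Integration.integrable_add integrable_norm)
      also have "\<dots> = (LINT x|lborel. norm (f (x + h n) - f x)) + (LINT x|lborel. norm (g (x + h n) - g x))"
        using add(1,2) by (intro Bochner_Integration.integral_add)
          (auto intro!: tr Bochner_Integration.integrable_diff integrable_norm)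
      finally show "(LINT x|lborel. norm (f (x + h n) + g (x + h n) - (f x + g x)))
        \<le> (LINT x|lborel. norm (f (x + h n) - f x)) + (LINT x|lborel. norm (g (x + h n) - g x))" .
    qed
  qed simp
next
  case (lim f s)
  show ?case
  proof (rule translate_tendsto_L1_approx)
    fix e :: real assume "e > 0"
    have [measurable]: "f \<in> borel_measurable borel" "\<And>i. s i \<in> borel_measurable borel"
      using lim(1,4) by auto
    have "(\<lambda>i. LINT x|lborel. norm (f x - s i x)) \<longlonglongrightarrow> (LINT x|(lborel :: 'a measure). 0)"
    proof (rule integral_dominated_convergence[where w="\<lambda>x. 3 * norm (f x)"])
      show "AE x in lborel. (\<lambda>i. norm (f x - s i x)) \<longlonglongrightarrow> 0"
      proof (rule AE_I2)
        fix x
        have "(\<lambda>i. norm (f x - s i x)) \<longlonglongrightarrow> norm (f x - f x)"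
          using lim(2)[of x] by (intro tendsto_intros) auto
        then show "(\<lambda>i. norm (f x - s i x)) \<longlonglongrightarrow> 0" by simp
      qed
      show "AE x in lborel. norm (norm (f x - s i x)) \<le> 3 * norm (f x)" for i
      proof (rule AE_I2)
        fix x show "norm (norm (f x - s i x)) \<le> 3 * norm (f x)"
          using lim(3)[of x i] norm_triangle_ineq4[of "f x" "s i x"] by simp
      qed
    qed (use lim(4) in auto)
    then have "(\<lambda>i. LINT x|lborel. norm (f x - s i x)) \<longlonglongrightarrow> 0" by simp
    from LIMSEQ_D[OF this \<open>e > 0\<close>] obtain i where "(LINT x|lborel. norm (f x - s i x)) < e"
      by auto
    then show "\<exists>G. integrable lborel G \<and> (LINT x|lborel. norm (f x - G x)) < e \<and>
        (\<lambda>n. LINT x|lborel. norm (G (x + h n) - G x)) \<longlonglongrightarrow> 0"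
      using lim(1,5) by blast
  qed fact
qed

section \<open>Weak partial derivatives\<close>

lemma test_field_translate:
  fixes \<phi> :: "'a::euclidean_space \<Rightarrow> 'a"
  assumes "test_field \<phi>"
  shows "test_field (\<lambda>x. \<phi> (x + h))"
proof -
  obtain D :: "'a \<Rightarrow> 'a \<Rightarrow>\<^sub>L 'a" where D: "continuous_on UNIV D"
    "\<And>x. (\<phi> has_derivative blinfun_apply (D x)) (at x)"
    and K: "compact (closure {x. \<phi> x \<noteq> 0})"
    using assms unfolding test_field_def by blast
  show ?thesis
    unfolding test_field_def
  proof (intro conjI exI allI)
    show "continuous_on UNIV (\<lambda>x. D (x + h))"
      by (rule continuous_on_compose2[OF D(1)]) (auto intro!: continuous_intros)
    show "((\<lambda>x. \<phi> (x + h)) has_derivative blinfun_apply (D (x + h))) (at x)" for x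
    proof -
      have "((\<lambda>x. x + h) has_derivative (\<lambda>x. x)) (at x)"
        by (auto intro!: derivative_eq_intros)
      from has_derivative_compose[OF this D(2)] show ?thesis .
    qed
    have "{x. \<phi> (x + h) \<noteq> 0} = (\<lambda>x. x - h) ` {x. \<phi> x \<noteq> 0}"
      by (force simp: image_iff intro: exI[of _ "_ + h"])
    then have "{x. \<phi> (x + h) \<noteq> 0} = (+) (- h) ` {x. \<phi> x \<noteq> 0}" by simp
    then show "compact (closure {x. \<phi> (x + h) \<noteq> 0})"
      using K by (simp add: bounded_translation del: uminus_add_conv_diff)
  qed
qed

text \<open>Testing against such fields isolates a single partial derivative: for a basis vector
  \<open>b\<close> the divergence of \<open>along b \<phi>\<close> is the derivative of \<open>\<phi> \<bullet> b\<close> in direction \<open>b\<close>.\<close>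
definition along :: "'a::euclidean_space \<Rightarrow> ('a \<Rightarrow> 'a) \<Rightarrow> 'a \<Rightarrow> 'a" where
  "along b \<phi> x = (\<phi> x \<bullet> b) *\<^sub>R b"

lemma test_field_along:
  fixes \<phi> :: "'a::euclidean_space \<Rightarrow> 'a"
  assumes "test_field \<phi>"
  shows "test_field (along b \<phi>)"
proof -
  obtain D :: "'a \<Rightarrow> 'a \<Rightarrow>\<^sub>L 'a" where D: "continuous_on UNIV D"
    "\<And>x. (\<phi> has_derivative blinfun_apply (D x)) (at x)"
    and K: "compact (closure {x. \<phi> x \<noteq> 0})"
    using assms unfolding test_field_def by blast
  have bl: "bounded_linear (\<lambda>v. (blinfun_apply (D x) v \<bullet> b) *\<^sub>R b)" for x
    by (intro bounded_linear_intros)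
  show ?thesis
    unfolding test_field_def along_def
  proof (intro conjI exI allI)
    show "continuous_on UNIV (\<lambda>x. Blinfun (\<lambda>v. (D x v \<bullet> b) *\<^sub>R b))"
      using D(1) by (intro continuous_on_blinfun_componentwise)
        (auto simp: bounded_linear_Blinfun_apply[OF bl] intro!: continuous_intros)
    show "((\<lambda>x. (\<phi> x \<bullet> b) *\<^sub>R b) has_derivative
        blinfun_apply (Blinfun (\<lambda>v. (D x v \<bullet> b) *\<^sub>R b))) (at x)" for x
      unfolding bounded_linear_Blinfun_apply[OF bl] by (intro derivative_intros D)
    have "{x. (\<phi> x \<bullet> b) *\<^sub>R b \<noteq> 0} \<subseteq> {x. \<phi> x \<noteq> 0}" by auto
    then show "compact (closure {x. (\<phi> x \<bullet> b) *\<^sub>R b \<noteq> 0})"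
      using K by (simp add: bounded_subset)
  qed
qed

lemma divergence_along:
  assumes "b \<in> Basis" "(\<phi> has_derivative D) (at x)"
  shows "divergence (along b \<phi>) x = D b \<bullet> b"
proof -
  have "(along b \<phi> has_derivative (\<lambda>h. (D h \<bullet> b) *\<^sub>R b)) (at x)"
    unfolding along_def by (intro derivative_intros assms)
  from divergence_eq[OF this]
  have "divergence (along b \<phi>) x = (\<Sum>i\<in>Basis. (D i \<bullet> b) * (b \<bullet> i))" by simp
  also have "\<dots> = (\<Sum>i\<in>Basis. if i = b then D b \<bullet> b else 0)"
    using assms(1) by (intro sum.cong) (auto simp: inner_Basis)
  finally show ?thesis using assms(1) by simp
qed

lemma along_has_real_derivative:
  assumes "b \<in> Basis" "test_field \<phi>"
  shows "((\<lambda>s. \<phi> (x + s *\<^sub>R b) \<bullet> b) has_real_derivative divergence (along b \<phi>) (x + s *\<^sub>R b)) (at s)"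
proof -
  obtain D where D: "\<And>x. (\<phi> has_derivative blinfun_apply (D x)) (at x)"
    using assms(2) unfolding test_field_def by blast
  have "((\<lambda>s. x + s *\<^sub>R b) has_derivative (\<lambda>h. h *\<^sub>R b)) (at s)"
    by (auto intro!: derivative_eq_intros)
  from has_derivative_compose[OF this D]
  have "((\<lambda>s. \<phi> (x + s *\<^sub>R b) \<bullet> b) has_derivative (\<lambda>h. D (x + s *\<^sub>R b) (h *\<^sub>R b) \<bullet> b)) (at s)"
    by (rule has_derivative_inner_left)
  moreover have "(\<lambda>h. D (x + s *\<^sub>R b) (h *\<^sub>R b) \<bullet> b) = (*) (D (x + s *\<^sub>R b) b \<bullet> b)"
    by (auto simp: blinfun.scaleR_right mult.commute)
  ultimately show ?thesis
    unfolding has_field_derivative_def divergence_along[OF assms(1) D] by simp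
qed

lemma divergence_sum_along:
  fixes \<phi> :: "'a::euclidean_space \<Rightarrow> 'a"
  assumes "test_field \<phi>"
  shows "divergence \<phi> x = (\<Sum>b\<in>Basis. divergence (along b \<phi>) x)"
proof -
  obtain D :: "'a \<Rightarrow> 'a \<Rightarrow>\<^sub>L 'a" where D: "\<And>x. (\<phi> has_derivative blinfun_apply (D x)) (at x)"
    using assms unfolding test_field_def by blast
  show ?thesis using divergence_along[OF _ D] divergence_eq[OF D] by simp
qed

lemma integrable_mult_test_component:
  fixes F :: "'a::euclidean_space \<Rightarrow> real"
  assumes "integrable lborel F" "test_field \<phi>"
  shows "integrable lborel (\<lambda>x. F x * (\<phi> x \<bullet> b))"
proof -
  have "integrable lborel (\<lambda>x. (F x *\<^sub>R b) \<bullet> \<phi> x)"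
    using assms(1) by (intro integrable_inner_test_field assms(2)) simp
  then show ?thesis by (simp add: inner_commute[of b])
qed
definition has_weak_partial :: "'a::euclidean_space \<Rightarrow> ('a \<Rightarrow> real) \<Rightarrow> ('a \<Rightarrow> real) \<Rightarrow> bool" where
  "has_weak_partial b f g \<longleftrightarrow> integrable lborel f \<and> integrable lborel g \<and>
     (\<forall>\<phi>. test_field \<phi> \<longrightarrow>
        (LINT x|lborel. f x * divergence (along b \<phi>) x) = - (LINT x|lborel. g x * (\<phi> x \<bullet> b)))"

lemma integrable_iff_components:
  fixes g :: "'a::euclidean_space \<Rightarrow> 'a"
  shows "integrable lborel g \<longleftrightarrow> (\<forall>b\<in>Basis. integrable lborel (\<lambda>x. g x \<bullet> b))"
proof
  assume *: "\<forall>b\<in>Basis. integrable lborel (\<lambda>x. g x \<bullet> b)"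
  have "integrable lborel (\<lambda>x. \<Sum>b\<in>Basis. (g x \<bullet> b) *\<^sub>R b)"
    using * by (intro Bochner_Integration.integrable_sum integrable_scaleR_left) auto
  then show "integrable lborel g" by (simp add: euclidean_representation)
qed auto

lemma has_weak_gradient_iff_partials:
  fixes g :: "'a::euclidean_space \<Rightarrow> 'a"
  shows "has_weak_gradient f g \<longleftrightarrow> (\<forall>b\<in>Basis. has_weak_partial b f (\<lambda>x. g x \<bullet> b))"
proof
  assume fg: "has_weak_gradient f g"
  show "\<forall>b\<in>Basis. has_weak_partial b f (\<lambda>x. g x \<bullet> b)"
    unfolding has_weak_partial_def
  proof (intro ballI conjI allI impI)
    fix b :: 'a and \<phi> :: "'a \<Rightarrow> 'a" assume "test_field \<phi>"
    then have "(LINT x|lborel. f x * divergence (along b \<phi>) x) = - (LINT x|lborel. g x \<bullet> along b \<phi> x)"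
      using fg test_field_along by (auto simp: has_weak_gradient_def)
    then show "(LINT x|lborel. f x * divergence (along b \<phi>) x) = - (LINT x|lborel. (g x \<bullet> b) * (\<phi> x \<bullet> b))"
      by (simp add: along_def mult.commute)
  qed (use fg in \<open>auto simp: has_weak_gradient_def\<close>)
next
  assume *: "\<forall>b\<in>Basis. has_weak_partial b f (\<lambda>x. g x \<bullet> b)"
  have f: "integrable lborel f"
    using * nonempty_Basis unfolding has_weak_partial_def by blast
  have g: "integrable lborel g"
    using * by (auto simp: integrable_iff_components has_weak_partial_def)
  show "has_weak_gradient f g"
    unfolding has_weak_gradient_def
  proof (intro conjI allI impI f g)
    fix \<phi> :: "'a \<Rightarrow> 'a" assume \<phi>: "test_field \<phi>"
    have "(LINT x|lborel. f x * divergence \<phi> x)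
        = (\<Sum>b\<in>Basis. LINT x|lborel. f x * divergence (along b \<phi>) x)"
      unfolding divergence_sum_along[OF \<phi>] sum_distrib_left
      by (intro Bochner_Integration.integral_sum integrable_mult_divergence f test_field_along \<phi>)
    also have "\<dots> = - (\<Sum>b\<in>Basis. LINT x|lborel. (g x \<bullet> b) * (\<phi> x \<bullet> b))"
      using * \<phi> by (simp add: has_weak_partial_def sum_negf)
    also have "(\<Sum>b\<in>Basis. LINT x|lborel. (g x \<bullet> b) * (\<phi> x \<bullet> b)) = (LINT x|lborel. (\<Sum>b\<in>Basis. (g x \<bullet> b) * (\<phi> x \<bullet> b)))"
    proof (rule Bochner_Integration.integral_sum[symmetric])
      fix b :: 'a
      have "integrable lborel (\<lambda>x. g x \<bullet> along b \<phi> x)"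
        by (rule integrable_inner_test_field[OF g test_field_along[OF \<phi>]])
      then show "integrable lborel (\<lambda>x. (g x \<bullet> b) * (\<phi> x \<bullet> b))"
        by (simp add: along_def mult.commute)
    qed
    also have "(\<lambda>x. \<Sum>b\<in>Basis. (g x \<bullet> b) * (\<phi> x \<bullet> b)) = (\<lambda>x. g x \<bullet> \<phi> x)"
      by (simp add: euclidean_inner[symmetric])
    finally show "(LINT x|lborel. f x * divergence \<phi> x) = - (LINT x|lborel. g x \<bullet> \<phi> x)" .
  qed
qed

section \<open>Averages over segments\<close>

definition segment_average :: "'a::euclidean_space \<Rightarrow> ('a \<Rightarrow> real) \<Rightarrow> 'a \<Rightarrow> real" where
  "segment_average h F x = (LINT s|lborel. indicator {0..1} s * F (x + s *\<^sub>R h))"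

text \<open>The integrability behind every exchange of integrals below.  In each use \<open>h = 0\<close> or
  \<open>k = 0\<close>: only one of the two factors is translated along the segment, and passing from one
  case to the other is how averages move between them.\<close>
lemma integrable_segment_kernel:
  fixes F u :: "'a::euclidean_space \<Rightarrow> real"
  assumes F: "integrable lborel F" and [measurable]: "u \<in> borel_measurable borel"
    and B: "\<And>x. \<bar>u x\<bar> \<le> B"
  shows "integrable (lborel \<Otimes>\<^sub>M lborel) (\<lambda>(s, x). indicator {0..1::real} s * (F (x + s *\<^sub>R h) * u (x + s *\<^sub>R k)))"
proof (rule lborel_pair.Fubini_integrable)
  have [measurable]: "F \<in> borel_measurable borel" using F by auto
  show m: "(\<lambda>(s, x). indicator {0..1::real} s * (F (x + s *\<^sub>R h) * u (x + s *\<^sub>R k)))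
      \<in> borel_measurable (lborel \<Otimes>\<^sub>M lborel)"
    by measurable
  have slice: "integrable lborel (\<lambda>x. F (x + s *\<^sub>R h) * u (x + s *\<^sub>R k))" for s
  proof (rule Bochner_Integration.integrable_bound)
    show "integrable lborel (\<lambda>x. B * F (x + s *\<^sub>R h))"
      by (intro integrable_mult_right integrable_lborel_translate F)
    show "AE x in lborel. norm (F (x + s *\<^sub>R h) * u (x + s *\<^sub>R k)) \<le> norm (B * F (x + s *\<^sub>R h))"
    proof (rule AE_I2)
      fix x
      show "norm (F (x + s *\<^sub>R h) * u (x + s *\<^sub>R k)) \<le> norm (B * F (x + s *\<^sub>R h))"
        using mult_left_mono[OF order_trans[OF B[of "x + s *\<^sub>R k"] abs_ge_self] abs_ge_zero[of "F (x + s *\<^sub>R h)"]]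
        by (simp add: abs_mult mult.commute)
    qed
  qed measurable
  show "AE s in lborel. integrable lborel
      (\<lambda>x. case (s, x) of (s, x) \<Rightarrow> indicator {0..1::real} s * (F (x + s *\<^sub>R h) * u (x + s *\<^sub>R k)))"
    using slice by (auto intro!: AE_I2)
  show "integrable lborel (\<lambda>s. LINT x|lborel. norm
      (case (s, x) of (s, x) \<Rightarrow> indicator {0..1::real} s * (F (x + s *\<^sub>R h) * u (x + s *\<^sub>R k))))"
  proof (rule Bochner_Integration.integrable_bound)
    show "integrable lborel (\<lambda>s. indicator {0..1::real} s * (B * (LINT x|lborel. \<bar>F x\<bar>)))"
      by (intro integrable_mult_left) simp
    show "AE s in lborel. norm (LINT x|lborel. norm
        (case (s, x) of (s, x) \<Rightarrow> indicator {0..1::real} s * (F (x + s *\<^sub>R h) * u (x + s *\<^sub>R k))))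
        \<le> norm (indicator {0..1::real} s * (B * (LINT x|lborel. \<bar>F x\<bar>)))"
    proof (rule AE_I2)
      fix s :: real
      have "(LINT x|lborel. \<bar>F (x + s *\<^sub>R h) * u (x + s *\<^sub>R k)\<bar>) \<le> (LINT x|lborel. B * \<bar>F (x + s *\<^sub>R h)\<bar>)"
      proof (rule integral_mono)
        show "integrable lborel (\<lambda>x. B * \<bar>F (x + s *\<^sub>R h)\<bar>)"
          by (intro integrable_mult_right integrable_abs integrable_lborel_translate F)
        show "\<bar>F (x + s *\<^sub>R h) * u (x + s *\<^sub>R k)\<bar> \<le> B * \<bar>F (x + s *\<^sub>R h)\<bar>" for x
          using mult_left_mono[OF B[of "x + s *\<^sub>R k"] abs_ge_zero[of "F (x + s *\<^sub>R h)"]]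
          by (simp add: abs_mult mult.commute)
      qed (intro integrable_abs slice)
      also have "\<dots> = B * (LINT x|lborel. \<bar>F x\<bar>)"
        using integral_lborel_translate[of "\<lambda>x. \<bar>F x\<bar>"] by simp
      finally show "norm (LINT x|lborel. norm
        (case (s, x) of (s, x) \<Rightarrow> indicator {0..1::real} s * (F (x + s *\<^sub>R h) * u (x + s *\<^sub>R k))))
        \<le> norm (indicator {0..1::real} s * (B * (LINT x|lborel. \<bar>F x\<bar>)))"
        by (auto simp: indicator_def intro: order_trans)
    qed
  qed (use m in measurable)
qed

text \<open>By translation invariance the averages along \<open>h\<close> and \<open>- h\<close> are adjoint to each other.\<close>
lemma segment_average_Fubini:
  fixes F u :: "'a::euclidean_space \<Rightarrow> real"
  assumes F: "integrable lborel F" and u[measurable]: "u \<in> borel_measurable borel"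
    and B: "\<And>x. \<bar>u x\<bar> \<le> B"
  shows "(LINT x|lborel. F x * segment_average (- h) u x) = (LINT x|lborel. segment_average h F x * u x)"
proof -
  have [measurable]: "F \<in> borel_measurable borel" using F by auto
  have "(LINT x|lborel. F x * segment_average (- h) u x)
      = (LINT x|lborel. LINT s|lborel. indicator {0..1::real} s * (F (x + s *\<^sub>R 0) * u (x + s *\<^sub>R (- h))))"
    unfolding segment_average_def
    by (simp add: mult.left_commute[of _ "F _"] flip: integral_mult_right_zero)
  also have "\<dots> = (LINT s|lborel. LINT x|lborel. indicator {0..1::real} s * (F (x + s *\<^sub>R 0) * u (x + s *\<^sub>R (- h))))"
    by (rule lborel_pair.Fubini_integral[OF integrable_segment_kernel[OF F u B]])
  also have "\<dots> = (LINT s|lborel. LINT x|lborel. indicator {0..1::real} s * (F (x + s *\<^sub>R h) * u (x + s *\<^sub>R 0)))"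
  proof (rule Bochner_Integration.integral_cong[OF refl])
    fix s :: real
    show "(LINT x|lborel. indicator {0..1::real} s * (F (x + s *\<^sub>R 0) * u (x + s *\<^sub>R (- h))))
      = (LINT x|lborel. indicator {0..1::real} s * (F (x + s *\<^sub>R h) * u (x + s *\<^sub>R 0)))"
      using integral_lborel_translate[of "\<lambda>x. indicator {0..1::real} s * (F x * u (x - s *\<^sub>R h))" "s *\<^sub>R h"]
      by auto
  qed
  also have "\<dots> = (LINT x|lborel. LINT s|lborel. indicator {0..1::real} s * (F (x + s *\<^sub>R h) * u (x + s *\<^sub>R 0)))"
    by (rule lborel_pair.Fubini_integral[OF integrable_segment_kernel[OF F u B], symmetric])
  also have "\<dots> = (LINT x|lborel. segment_average h F x * u x)"
    unfolding segment_average_def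
    by (simp add: mult.assoc[symmetric] flip: integral_mult_left_zero)
  finally show ?thesis .
qed

lemma integrable_segment_average:
  fixes F :: "'a::euclidean_space \<Rightarrow> real"
  assumes F: "integrable lborel F"
  shows "integrable lborel (segment_average h F)"
    and "AE x in lborel. integrable lborel (\<lambda>s. indicator {0..1::real} s * F (x + s *\<^sub>R h))"
proof -
  have *: "integrable (lborel \<Otimes>\<^sub>M lborel) (\<lambda>(s, x). indicator {0..1::real} s * F (x + s *\<^sub>R h))"
    using integrable_segment_kernel[OF F, of "\<lambda>_. 1" 1 h 0] by simp
  show "integrable lborel (segment_average h F)"
    using lborel_pair.integrable_snd[OF *] unfolding segment_average_def .
  show "AE x in lborel. integrable lborel (\<lambda>s. indicator {0..1::real} s * F (x + s *\<^sub>R h))"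
    by (rule lborel_pair.AE_integrable_snd[OF *])
qed

lemma segment_average_L1_bound:
  fixes F :: "'a::euclidean_space \<Rightarrow> real"
  assumes F: "integrable lborel F"
  shows "(LINT x|lborel. \<bar>segment_average h F x - F x\<bar>)
    \<le> (LINT s|lborel. indicator {0..1} s * (LINT x|lborel. \<bar>F (x + s *\<^sub>R h) - F x\<bar>))"
proof -
  let ?k = "\<lambda>s x. indicator {0..1::real} s * (F (x + s *\<^sub>R h) - F x)"
  have "integrable (lborel \<Otimes>\<^sub>M lborel) (\<lambda>p. (\<lambda>(s, x). indicator {0..1::real} s * F (x + s *\<^sub>R h)) p
      - (\<lambda>(s, x). indicator {0..1::real} s * F x) p)"
    using integrable_segment_kernel[OF F, of "\<lambda>_. 1" 1 h 0] integrable_segment_kernel[OF F, of "\<lambda>_. 1" 1 0 0]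
    by (intro Bochner_Integration.integrable_diff) simp_all
  then have k: "integrable (lborel \<Otimes>\<^sub>M lborel) (case_prod ?k)"
    by (simp add: case_prod_unfold right_diff_distrib)
  then have nk: "integrable (lborel \<Otimes>\<^sub>M lborel) (\<lambda>(s, x). \<bar>?k s x\<bar>)"
    using integrable_norm[OF k] by (simp add: case_prod_unfold)
  have "AE x in lborel. segment_average h F x - F x = (LINT s|lborel. ?k s x)"
    using integrable_segment_average(2)[OF F, of h]
  proof eventually_elim
    case (elim x)
    have "(LINT s|lborel. ?k s x) = (LINT s|lborel. indicator {0..1::real} s * F (x + s *\<^sub>R h))
        - (LINT s|lborel. indicator {0..1::real} s * F x)"
      unfolding right_diff_distrib
      by (intro Bochner_Integration.integral_diff elim integrable_mult_left) simp
    then show ?case by (simp add: segment_average_def)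
  qed
  then have le: "AE x in lborel. \<bar>segment_average h F x - F x\<bar> \<le> (LINT s|lborel. \<bar>?k s x\<bar>)"
  proof eventually_elim
    case (elim x)
    show ?case unfolding elim by (rule integral_abs_bound)
  qed
  have "(LINT x|lborel. \<bar>segment_average h F x - F x\<bar>) \<le> (LINT x|lborel. LINT s|lborel. \<bar>?k s x\<bar>)"
    by (intro integral_mono_AE le integrable_abs Bochner_Integration.integrable_diff integrable_segment_average F
        lborel_pair.integrable_snd[OF nk])
  also have "\<dots> = (LINT s|lborel. LINT x|lborel. \<bar>?k s x\<bar>)"
    using lborel_pair.Fubini_integral[OF nk] .
  also have "\<dots> = (LINT s|lborel. indicator {0..1} s * (LINT x|lborel. \<bar>F (x + s *\<^sub>R h) - F x\<bar>))"
    by (simp add: abs_mult)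
  finally show ?thesis .
qed

lemma segment_average_tendsto_L1:
  fixes F :: "'a::euclidean_space \<Rightarrow> real"
  assumes F: "integrable lborel F" and h: "h \<longlonglongrightarrow> 0"
  shows "(\<lambda>n. LINT x|lborel. \<bar>segment_average (h n) F x - F x\<bar>) \<longlonglongrightarrow> 0"
proof (rule tendsto_sandwich[OF _ _ tendsto_const])
  let ?w = "\<lambda>n s. indicator {0..1} s * (LINT x|lborel. \<bar>F (x + s *\<^sub>R h n) - F x\<bar>)"
  have [measurable]: "F \<in> borel_measurable borel" using F by auto
  have "(\<lambda>n. LINT s|lborel. ?w n s) \<longlonglongrightarrow> (LINT s|(lborel :: real measure). 0)"
  proof (rule integral_dominated_convergence)
    show "integrable lborel (\<lambda>s. indicator {0..1::real} s * (2 * (LINT x|lborel. \<bar>F x\<bar>)))"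
      by (intro integrable_mult_left) simp
    show "AE s in lborel. (\<lambda>n. ?w n s) \<longlonglongrightarrow> 0"
    proof (rule AE_I2)
      fix s :: real
      have "(\<lambda>n. s *\<^sub>R h n) \<longlonglongrightarrow> 0"
        using tendsto_scaleR[OF tendsto_const h, of s] by simp
      from translate_tendsto_L1[OF F this]
      have "(\<lambda>n. LINT x|lborel. \<bar>F (x + s *\<^sub>R h n) - F x\<bar>) \<longlonglongrightarrow> 0" by simp
      from tendsto_mult[OF tendsto_const this] show "(\<lambda>n. ?w n s) \<longlonglongrightarrow> 0" by simp
    qed
    fix n
    show "AE s in lborel. norm (?w n s) \<le> indicator {0..1::real} s * (2 * (LINT x|lborel. \<bar>F x\<bar>))"
    proof (rule AE_I2)
      fix s :: real
      have "(LINT x|lborel. \<bar>F (x + s *\<^sub>R h n) - F x\<bar>) \<le> (LINT x|lborel. \<bar>F (x + s *\<^sub>R h n)\<bar> + \<bar>F x\<bar>)"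
        using F by (intro integral_mono abs_triangle_ineq4)
          (auto intro!: integrable_abs Bochner_Integration.integrable_diff Bochner_Integration.integrable_add integrable_lborel_translate)
      also have "\<dots> = (LINT x|lborel. \<bar>F (x + s *\<^sub>R h n)\<bar>) + (LINT x|lborel. \<bar>F x\<bar>)"
        using F by (intro Bochner_Integration.integral_add)
          (auto intro!: integrable_abs integrable_lborel_translate)
      also have "\<dots> = 2 * (LINT x|lborel. \<bar>F x\<bar>)"
        using integral_lborel_translate[of "\<lambda>x. \<bar>F x\<bar>"] by simp
      finally show "norm (?w n s) \<le> indicator {0..1::real} s * (2 * (LINT x|lborel. \<bar>F x\<bar>))"
        by (auto simp: indicator_def)
    qed
  qed measurable
  then show "(\<lambda>n. LINT s|lborel. ?w n s) \<longlonglongrightarrow> 0" by simp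
  show "\<forall>\<^sub>F n in sequentially. (LINT x|lborel. \<bar>segment_average (h n) F x - F x\<bar>) \<le> (LINT s|lborel. ?w n s)"
    by (intro always_eventually allI segment_average_L1_bound F)
qed simp

text \<open>The fundamental theorem of calculus on the segment from \<open>x\<close> to \<open>x + t *\<^sub>R b\<close>.\<close>
lemma along_increment:
  assumes "b \<in> Basis" "test_field \<phi>"
  shows "\<phi> (x + t *\<^sub>R b) \<bullet> b - \<phi> x \<bullet> b = t * segment_average (t *\<^sub>R b) (divergence (along b \<phi>)) x"
proof -
  let ?p = "divergence (along b \<phi>)"
  have "(LINT s|lborel. indicator {0..1} s *\<^sub>R (t * ?p (x + s *\<^sub>R t *\<^sub>R b)))
      = \<phi> (x + 1 *\<^sub>R t *\<^sub>R b) \<bullet> b - \<phi> (x + 0 *\<^sub>R t *\<^sub>R b) \<bullet> b"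
  proof (rule integral_FTC_atLeastAtMost)
    fix s :: real
    have "((\<lambda>s. \<phi> (x + s *\<^sub>R b) \<bullet> b) has_real_derivative ?p (x + (s * t) *\<^sub>R b)) (at (s * t))"
      by (rule along_has_real_derivative[OF assms])
    moreover have "((\<lambda>s. s * t) has_real_derivative t) (at s within {0..1})"
      by (auto intro!: derivative_eq_intros)
    ultimately have "((\<lambda>s. \<phi> (x + (s * t) *\<^sub>R b) \<bullet> b) has_real_derivative ?p (x + (s * t) *\<^sub>R b) * t) (at s within {0..1})"
      by (rule DERIV_chain2)
    then show "((\<lambda>s. \<phi> (x + s *\<^sub>R t *\<^sub>R b) \<bullet> b) has_vector_derivative t * ?p (x + s *\<^sub>R t *\<^sub>R b)) (at s within {0..1})"
      by (simp add: has_real_derivative_iff_has_vector_derivative mult.commute)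
  next
    show "continuous_on {0..1} (\<lambda>s. t * ?p (x + s *\<^sub>R t *\<^sub>R b))"
      by (intro continuous_intros continuous_on_compose2[OF test_field_divergence_continuous[OF test_field_along[OF assms(2)]]]) auto
  qed simp
  then show ?thesis
    by (simp add: segment_average_def mult.left_commute[of _ t])
qed

section \<open>Difference quotients\<close>

definition difference_quotient :: "'a::euclidean_space \<Rightarrow> real \<Rightarrow> ('a \<Rightarrow> real) \<Rightarrow> 'a \<Rightarrow> real" where
  "difference_quotient b t f x = (f (x + t *\<^sub>R b) - f x) / t"

lemma integrable_difference_quotient:
  "integrable lborel f \<Longrightarrow> integrable lborel (difference_quotient b t f)"
  unfolding difference_quotient_def
  by (intro integrable_divide Bochner_Integration.integrable_diff integrable_lborel_translate) auto

text \<open>Translation invariance moves the difference quotient onto the test function, where it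
  becomes an average of a classical derivative.\<close>
lemma difference_quotient_by_parts:
  fixes f :: "'a::euclidean_space \<Rightarrow> real"
  assumes f: "integrable lborel f" and b: "b \<in> Basis" and \<phi>: "test_field \<phi>" and t: "t \<noteq> 0"
  shows "(LINT x|lborel. difference_quotient b t f x * (\<phi> x \<bullet> b))
     = - (LINT x|lborel. f x * segment_average (- (t *\<^sub>R b)) (divergence (along b \<phi>)) x)"
proof -
  have [measurable]: "f \<in> borel_measurable borel" using f by auto
  have [measurable]: "\<phi> \<in> borel_measurable borel"
    by (rule borel_measurable_continuous_onI[OF test_field_continuous[OF \<phi>]])
  note int = integrable_mult_test_component[OF _ test_field_translate[OF \<phi>], where b=b]
    and int0 = integrable_mult_test_component[OF _ \<phi>, where b=b]
  have "(LINT x|lborel. difference_quotient b t f x * (\<phi> x \<bullet> b))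
      = (LINT x|lborel. (f (x + t *\<^sub>R b) * (\<phi> x \<bullet> b) - f x * (\<phi> x \<bullet> b)) / t)"
    by (simp add: difference_quotient_def left_diff_distrib)
  also have "\<dots> = ((LINT x|lborel. f (x + t *\<^sub>R b) * (\<phi> x \<bullet> b)) - (LINT x|lborel. f x * (\<phi> x \<bullet> b))) / t"
    using f by (simp add: int0 integrable_lborel_translate)
  also have "(LINT x|lborel. f (x + t *\<^sub>R b) * (\<phi> x \<bullet> b)) = (LINT x|lborel. f x * (\<phi> (x + - (t *\<^sub>R b)) \<bullet> b))"
    using integral_lborel_translate[of "\<lambda>x. f x * (\<phi> (x + - (t *\<^sub>R b)) \<bullet> b)" "t *\<^sub>R b"] by simp
  also have "((LINT x|lborel. f x * (\<phi> (x + - (t *\<^sub>R b)) \<bullet> b)) - (LINT x|lborel. f x * (\<phi> x \<bullet> b))) / t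
     = (LINT x|lborel. (f x * (\<phi> (x + - (t *\<^sub>R b)) \<bullet> b) - f x * (\<phi> x \<bullet> b)) / t)"
    using f by (simp add: int0 int del: add_uminus_conv_diff)
  also have "\<dots> = (LINT x|lborel. - (f x * segment_average (- (t *\<^sub>R b)) (divergence (along b \<phi>)) x))"
  proof (rule Bochner_Integration.integral_cong[OF refl])
    fix x
    have "(f x * (\<phi> (x + - (t *\<^sub>R b)) \<bullet> b) - f x * (\<phi> x \<bullet> b)) / t
       = f x * ((\<phi> (x + (- t) *\<^sub>R b) \<bullet> b - \<phi> x \<bullet> b) / t)"
      by (simp add: right_diff_distrib)
    also have "\<dots> = - (f x * segment_average (- (t *\<^sub>R b)) (divergence (along b \<phi>)) x)"
      unfolding along_increment[OF b \<phi>] using t by simp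
    finally show "(f x * (\<phi> (x + - (t *\<^sub>R b)) \<bullet> b) - f x * (\<phi> x \<bullet> b)) / t
       = - (f x * segment_average (- (t *\<^sub>R b)) (divergence (along b \<phi>)) x)" .
  qed
  finally show ?thesis by simp
qed

text \<open>An average of translates of a test field can be used for testing as well, because every
  translate can; the average itself is never differentiated.\<close>
lemma weak_partial_segment:
  fixes f :: "'a::euclidean_space \<Rightarrow> real"
  assumes fg: "has_weak_partial b f g" and b: "b \<in> Basis" and \<phi>: "test_field \<phi>"
  shows "(LINT x|lborel. f x * segment_average (- h) (divergence (along b \<phi>)) x)
     = - (LINT x|lborel. segment_average h g x * (\<phi> x \<bullet> b))"
proof -
  have f: "integrable lborel f" and g: "integrable lborel g"
    using fg by (auto simp: has_weak_partial_def)
  note \<psi> = test_field_along[OF \<phi>, of b]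
  obtain B where B: "\<And>x. \<bar>divergence (along b \<phi>) x\<bar> \<le> B"
    using test_field_divergence_bounded[OF \<psi>] unfolding real_norm_def by blast
  obtain C where C: "\<And>x. norm (\<phi> x) \<le> C"
    using test_field_bounded[OF \<phi>] by blast
  have Cb: "\<bar>\<phi> x \<bullet> b\<bar> \<le> C" for x
    using Basis_le_norm[OF b, of "\<phi> x"] C[of x] by linarith
  have [measurable]: "\<phi> \<in> borel_measurable borel"
    by (rule borel_measurable_continuous_onI[OF test_field_continuous[OF \<phi>]])
  have pm: "divergence (along b \<phi>) \<in> borel_measurable borel"
    by (rule borel_measurable_continuous_onI[OF test_field_divergence_continuous[OF \<psi>]])
  have um: "(\<lambda>x. \<phi> x \<bullet> b) \<in> borel_measurable borel" by measurable
  have "(LINT x|lborel. f x * segment_average (- h) (divergence (along b \<phi>)) x)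
     = (LINT x|lborel. LINT s|lborel. indicator {0..1::real} s * (f (x + s *\<^sub>R 0) * divergence (along b \<phi>) (x + s *\<^sub>R (- h))))"
    unfolding segment_average_def
    by (simp add: mult.left_commute[of _ "f _"] flip: integral_mult_right_zero)
  also have "\<dots> = (LINT s|lborel. LINT x|lborel. indicator {0..1::real} s * (f (x + s *\<^sub>R 0) * divergence (along b \<phi>) (x + s *\<^sub>R (- h))))"
    by (rule lborel_pair.Fubini_integral[OF integrable_segment_kernel[OF f pm B]])
  also have "\<dots> = (LINT s|lborel. LINT x|lborel. - (indicator {0..1::real} s * (g (x + s *\<^sub>R 0) * (\<phi> (x + s *\<^sub>R (- h)) \<bullet> b))))"
  proof (rule Bochner_Integration.integral_cong[OF refl])
    fix s :: real
    let ?\<phi> = "\<lambda>x. \<phi> (x + s *\<^sub>R (- h))"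
    have t: "test_field ?\<phi>" by (rule test_field_translate[OF \<phi>])
    have "divergence (along b ?\<phi>) x = divergence (along b \<phi>) (x + s *\<^sub>R (- h))" for x
    proof -
      obtain D :: "'a \<Rightarrow> 'a \<Rightarrow>\<^sub>L 'a" where D: "\<And>x. (\<phi> has_derivative blinfun_apply (D x)) (at x)"
        using \<phi> unfolding test_field_def by blast
      have "((\<lambda>x. x + s *\<^sub>R (- h)) has_derivative (\<lambda>x. x)) (at x)"
        by (auto intro!: derivative_eq_intros)
      from has_derivative_compose[OF this D]
      have "(?\<phi> has_derivative blinfun_apply (D (x + s *\<^sub>R (- h)))) (at x)" .
      then show ?thesis using divergence_along[OF b] D by metis
    qed
    moreover have "(LINT x|lborel. f x * divergence (along b ?\<phi>) x) = - (LINT x|lborel. g x * (?\<phi> x \<bullet> b))"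
      using fg t unfolding has_weak_partial_def by blast
    ultimately have "(LINT x|lborel. f x * divergence (along b \<phi>) (x + s *\<^sub>R (- h))) = - (LINT x|lborel. g x * (?\<phi> x \<bullet> b))"
      by (simp only:)
    then show "(LINT x|lborel. indicator {0..1::real} s * (f (x + s *\<^sub>R 0) * divergence (along b \<phi>) (x + s *\<^sub>R (- h))))
       = (LINT x|lborel. - (indicator {0..1::real} s * (g (x + s *\<^sub>R 0) * (\<phi> (x + s *\<^sub>R (- h)) \<bullet> b))))"
      by simp
  qed
  also have "\<dots> = - (LINT s|lborel. LINT x|lborel. indicator {0..1::real} s * (g (x + s *\<^sub>R 0) * (\<phi> (x + s *\<^sub>R (- h)) \<bullet> b)))"
    by simp
  also have "(LINT s|lborel. LINT x|lborel. indicator {0..1::real} s * (g (x + s *\<^sub>R 0) * (\<phi> (x + s *\<^sub>R (- h)) \<bullet> b)))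
     = (LINT x|lborel. LINT s|lborel. indicator {0..1::real} s * (g (x + s *\<^sub>R 0) * (\<phi> (x + s *\<^sub>R (- h)) \<bullet> b)))"
    by (rule lborel_pair.Fubini_integral[OF integrable_segment_kernel[OF g um Cb], symmetric])
  also have "\<dots> = (LINT x|lborel. g x * segment_average (- h) (\<lambda>x. \<phi> x \<bullet> b) x)"
    unfolding segment_average_def
    by (simp add: mult.left_commute[of _ "g _"] flip: integral_mult_right_zero)
  also have "\<dots> = (LINT x|lborel. segment_average h g x * (\<phi> x \<bullet> b))"
    by (rule segment_average_Fubini[OF g um Cb])
  finally show ?thesis .
qed


text \<open>The mean value formula survives for weak derivatives: by \<open>difference_quotient_by_parts\<close> and
  \<open>weak_partial_segment\<close> both sides have the same integral against every test function.\<close>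
lemma difference_quotient_eq_segment_average:
  fixes f :: "'a::euclidean_space \<Rightarrow> real"
  assumes fg: "has_weak_partial b f g" and b: "b \<in> Basis" and t: "t \<noteq> 0"
  shows "AE x in lborel. difference_quotient b t f x = segment_average (t *\<^sub>R b) g x"
proof -
  have f: "integrable lborel f" and g: "integrable lborel g"
    using fg by (auto simp: has_weak_partial_def)
  let ?d = "\<lambda>x. difference_quotient b t f x - segment_average (t *\<^sub>R b) g x"
  note int = integrable_difference_quotient[OF f, of b t] integrable_segment_average(1)[OF g, of "t *\<^sub>R b"]
  have "AE x in lborel. ?d x *\<^sub>R b = 0"
  proof (rule zero_if_test_integrals_zero)
    show "integrable lborel (\<lambda>x. ?d x *\<^sub>R b)" using int by simp
    fix \<phi> :: "'a \<Rightarrow> 'a" assume \<phi>: "test_field \<phi>"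
    note i = integrable_mult_test_component[OF _ \<phi>, where b=b]
    have "(LINT x|lborel. (?d x *\<^sub>R b) \<bullet> \<phi> x)
      = (LINT x|lborel. difference_quotient b t f x * (\<phi> x \<bullet> b) - segment_average (t *\<^sub>R b) g x * (\<phi> x \<bullet> b))"
      by (simp add: inner_commute[of b] left_diff_distrib)
    also have "\<dots> = (LINT x|lborel. difference_quotient b t f x * (\<phi> x \<bullet> b))
        - (LINT x|lborel. segment_average (t *\<^sub>R b) g x * (\<phi> x \<bullet> b))"
      by (intro Bochner_Integration.integral_diff i int)
    also have "\<dots> = 0"
      using weak_partial_segment[OF fg b \<phi>, of "t *\<^sub>R b"] difference_quotient_by_parts[OF f b \<phi> t] by simp
    finally show "(LINT x|lborel. (?d x *\<^sub>R b) \<bullet> \<phi> x) = 0" .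
  qed
  then show ?thesis using b nonzero_Basis by auto
qed

proposition weak_partial_tendsto_L1:
  fixes f :: "'a::euclidean_space \<Rightarrow> real"
  assumes fg: "has_weak_partial b f g" and b: "b \<in> Basis"
    and t: "t \<longlonglongrightarrow> 0" "\<And>n. t n \<noteq> 0"
  shows "(\<lambda>n. LINT x|lborel. \<bar>difference_quotient b (t n) f x - g x\<bar>) \<longlonglongrightarrow> 0"
proof -
  have f: "integrable lborel f" and g: "integrable lborel g"
    using fg by (auto simp: has_weak_partial_def)
  have [measurable]: "g \<in> borel_measurable borel" using g by auto
  have [measurable]: "difference_quotient b s f \<in> borel_measurable borel"
    "segment_average h g \<in> borel_measurable borel" for s h
    using integrable_difference_quotient[OF f, of b s] integrable_segment_average(1)[OF g, of h] by auto
  have "(\<lambda>n. t n *\<^sub>R b) \<longlonglongrightarrow> 0"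
    using tendsto_scaleR[OF t(1) tendsto_const, of b] by simp
  from segment_average_tendsto_L1[OF g this]
  have "(\<lambda>n. LINT x|lborel. \<bar>segment_average (t n *\<^sub>R b) g x - g x\<bar>) \<longlonglongrightarrow> 0" .
  moreover have "(LINT x|lborel. \<bar>difference_quotient b (t n) f x - g x\<bar>)
      = (LINT x|lborel. \<bar>segment_average (t n *\<^sub>R b) g x - g x\<bar>)" for n
    by (rule integral_cong_AE)
      (use difference_quotient_eq_segment_average[OF fg b t(2)[of n]] in \<open>auto elim: eventually_mono\<close>)
  ultimately show ?thesis by simp
qed

text \<open>A single null sequence of step sizes, of either sign, suffices to recognise the weak
  derivative.  This freedom makes it possible to compare one-sided limits later.\<close>
proposition has_weak_partial_if_tendsto_L1:
  fixes f :: "'a::euclidean_space \<Rightarrow> real"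
  assumes f: "integrable lborel f" and g: "integrable lborel g" and b: "b \<in> Basis"
    and t: "t \<longlonglongrightarrow> 0" "\<And>n. t n \<noteq> 0"
    and lim: "(\<lambda>n. LINT x|lborel. \<bar>difference_quotient b (t n) f x - g x\<bar>) \<longlonglongrightarrow> 0"
  shows "has_weak_partial b f g"
  unfolding has_weak_partial_def
proof (intro conjI f g allI impI)
  fix \<phi> :: "'a \<Rightarrow> 'a" assume \<phi>: "test_field \<phi>"
  note \<psi> = test_field_along[OF \<phi>, of b]
  let ?p = "divergence (along b \<phi>)"
  let ?dq = "\<lambda>n. difference_quotient b (t n) f"
  obtain B where B: "B \<ge> 0" "\<And>x. \<bar>?p x\<bar> \<le> B"
    using test_field_divergence_bounded[OF \<psi>] unfolding real_norm_def by blast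
  obtain C where C: "C \<ge> 0" "\<And>x. norm (\<phi> x) \<le> C"
    using test_field_bounded[OF \<phi>] by blast
  have Cb: "\<bar>\<phi> x \<bullet> b\<bar> \<le> C" for x
    using Basis_le_norm[OF b, of "\<phi> x"] C(2)[of x] by linarith
  have [measurable]: "f \<in> borel_measurable borel" using f by auto
  have [measurable]: "\<phi> \<in> borel_measurable borel"
    by (rule borel_measurable_continuous_onI[OF test_field_continuous[OF \<phi>]])
  have [measurable]: "?p \<in> borel_measurable borel"
    by (rule borel_measurable_continuous_onI[OF test_field_divergence_continuous[OF \<psi>]])
  note i = integrable_mult_test_component[OF _ \<phi>, where b=b]
  note dq = integrable_difference_quotient[OF f, of b]
  have "(\<lambda>n. (LINT x|lborel. ?dq n x * (\<phi> x \<bullet> b)) - (LINT x|lborel. g x * (\<phi> x \<bullet> b))) \<longlonglongrightarrow> 0"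
  proof (rule tendsto_rabs_zero_cancel, rule tendsto_sandwich[OF _ _ tendsto_const])
    show "(\<lambda>n. C * (LINT x|lborel. \<bar>?dq n x - g x\<bar>)) \<longlonglongrightarrow> 0"
      using tendsto_mult[OF tendsto_const lim, of C] by simp
    show "\<forall>\<^sub>F n in sequentially. \<bar>(LINT x|lborel. ?dq n x * (\<phi> x \<bullet> b)) - (LINT x|lborel. g x * (\<phi> x \<bullet> b))\<bar>
        \<le> C * (LINT x|lborel. \<bar>?dq n x - g x\<bar>)"
    proof (rule always_eventually, rule allI)
      fix n
      have "\<bar>(LINT x|lborel. ?dq n x * (\<phi> x \<bullet> b)) - (LINT x|lborel. g x * (\<phi> x \<bullet> b))\<bar>
          = \<bar>LINT x|lborel. (?dq n x - g x) * (\<phi> x \<bullet> b)\<bar>"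
        unfolding left_diff_distrib
        by (subst Bochner_Integration.integral_diff) (auto intro: i dq g)
      also have "\<dots> \<le> (LINT x|lborel. \<bar>(?dq n x - g x) * (\<phi> x \<bullet> b)\<bar>)"
        by (rule integral_abs_bound)
      also have "\<dots> \<le> (LINT x|lborel. C * \<bar>?dq n x - g x\<bar>)"
      proof (rule integral_mono)
        show "\<bar>(?dq n x - g x) * (\<phi> x \<bullet> b)\<bar> \<le> C * \<bar>?dq n x - g x\<bar>" for x
          using mult_left_mono[OF Cb abs_ge_zero[of "?dq n x - g x"]]
          by (simp add: abs_mult mult.commute)
      qed (auto intro!: integrable_abs i dq g Bochner_Integration.integrable_diff)
      finally show "\<bar>(LINT x|lborel. ?dq n x * (\<phi> x \<bullet> b)) - (LINT x|lborel. g x * (\<phi> x \<bullet> b))\<bar>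
        \<le> C * (LINT x|lborel. \<bar>?dq n x - g x\<bar>)" by simp
    qed
  qed simp
  then have "(\<lambda>n. (LINT x|lborel. ?dq n x * (\<phi> x \<bullet> b))) \<longlonglongrightarrow> (LINT x|lborel. g x * (\<phi> x \<bullet> b))"
    by (simp add: LIM_zero_iff)
  moreover have "(\<lambda>n. (LINT x|lborel. ?dq n x * (\<phi> x \<bullet> b))) \<longlonglongrightarrow> - (LINT x|lborel. f x * ?p x)"
    unfolding difference_quotient_by_parts[OF f b \<phi> t(2)]
  proof (intro tendsto_minus integral_dominated_convergence)
    show "integrable lborel (\<lambda>x. B * \<bar>f x\<bar>)" using f by simp
    show "AE x in lborel. (\<lambda>n. f x * segment_average (- (t n *\<^sub>R b)) ?p x) \<longlonglongrightarrow> f x * ?p x"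
    proof (intro AE_I2 tendsto_mult tendsto_const)
      fix x
      have "((\<lambda>h. (\<phi> (x + (0 + h) *\<^sub>R b) \<bullet> b - \<phi> (x + 0 *\<^sub>R b) \<bullet> b) / h) \<longlongrightarrow> ?p (x + 0 *\<^sub>R b)) (at 0)"
        using along_has_real_derivative[OF b \<phi>, of x 0] unfolding DERIV_def .
      moreover have "filterlim (\<lambda>n. - t n) (at 0) sequentially"
        using t by (auto simp: filterlim_at intro!: tendsto_eq_intros)
      ultimately have "(\<lambda>n. (\<phi> (x + (0 + - t n) *\<^sub>R b) \<bullet> b - \<phi> (x + 0 *\<^sub>R b) \<bullet> b) / - t n) \<longlonglongrightarrow> ?p (x + 0 *\<^sub>R b)"
        by (rule filterlim_compose)
      moreover have "(\<phi> (x + (0 + - t n) *\<^sub>R b) \<bullet> b - \<phi> (x + 0 *\<^sub>R b) \<bullet> b) / - t n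
          = segment_average (- (t n *\<^sub>R b)) ?p x" for n
        using along_increment[OF b \<phi>, of x "- t n"] t(2)[of n] by simp
      ultimately show "(\<lambda>n. segment_average (- (t n *\<^sub>R b)) ?p x) \<longlonglongrightarrow> ?p x" by simp
    qed
    show "AE x in lborel. norm (f x * segment_average (- (t n *\<^sub>R b)) ?p x) \<le> B * \<bar>f x\<bar>" for n
    proof (rule AE_I2)
      fix x
      have "\<bar>segment_average (- (t n *\<^sub>R b)) ?p x\<bar>
          \<le> (LINT s|lborel. \<bar>indicator {0..1::real} s * ?p (x + s *\<^sub>R - (t n *\<^sub>R b))\<bar>)"
        unfolding segment_average_def by (rule integral_abs_bound)
      also have "\<dots> \<le> (LINT s|lborel. indicator {0..1::real} s * B)"
      proof (rule integral_mono_AE')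
        show "integrable lborel (\<lambda>s. indicator {0..1::real} s * B)"
          by (intro integrable_mult_left) simp
      qed (use B in \<open>auto simp: abs_mult indicator_def\<close>)
      finally have "\<bar>segment_average (- (t n *\<^sub>R b)) ?p x\<bar> \<le> B" by simp
      from mult_left_mono[OF this abs_ge_zero[of "f x"]]
      show "norm (f x * segment_average (- (t n *\<^sub>R b)) ?p x) \<le> B * \<bar>f x\<bar>"
        by (simp add: abs_mult mult.commute)
    qed
    show "(\<lambda>x. f x * segment_average (- (t n *\<^sub>R b)) ?p x) \<in> borel_measurable lborel" for n
      unfolding segment_average_def by measurable
  qed measurable
  ultimately show "(LINT x|lborel. f x * ?p x) = - (LINT x|lborel. g x * (\<phi> x \<bullet> b))"
    using LIMSEQ_unique by fastforce
qed

section \<open>Truncation of Sobolev functions\<close>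

text \<open>Replacing the increment \<open>f (x + t *\<^sub>R b) - f x\<close> inside \<open>P\<close> by its linearisation
  \<open>t * g x\<close> costs at most \<open>\<bar>difference_quotient b t f x - g x\<bar>\<close>, because \<open>P\<close> is nonexpansive,
  and this tends to \<open>0\<close> in \<open>L\<^sup>1\<close>.  What remains is a pointwise limit dominated by \<open>\<bar>g\<bar>\<close>.\<close>
proposition has_weak_partial_nonexpansive:
  fixes f :: "'a::euclidean_space \<Rightarrow> real" and P :: "real \<Rightarrow> real"
  assumes fg: "has_weak_partial b f g" and b: "b \<in> Basis"
    and t: "t \<longlonglongrightarrow> 0" "\<And>n. t n \<noteq> 0"
    and P: "P 0 = 0" "\<And>r s. \<bar>P r - P s\<bar> \<le> \<bar>r - s\<bar>"
    and q: "\<And>x. (\<lambda>n. (P (f x + t n * g x) - P (f x)) / t n) \<longlonglongrightarrow> q x"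
  shows "has_weak_partial b (\<lambda>x. P (f x)) q"
proof -
  have f: "integrable lborel f" and g: "integrable lborel g"
    using fg by (auto simp: has_weak_partial_def)
  have [measurable]: "f \<in> borel_measurable borel" "g \<in> borel_measurable borel" using f g by auto
  have "continuous_on UNIV P"
    unfolding continuous_on_iff using P(2) by (metis dist_real_def le_less_trans)
  then have [measurable]: "P \<in> borel_measurable borel"
    by (rule borel_measurable_continuous_onI)
  let ?R = "\<lambda>n x. (P (f x + t n * g x) - P (f x)) / t n"
  have R_bound: "\<bar>?R n x\<bar> \<le> \<bar>g x\<bar>" for n x
    using P(2)[of "f x + t n * g x" "f x"] t(2)[of n]
    by (simp add: abs_mult divide_le_eq mult.commute)
  have R: "integrable lborel (?R n)" for n
    by (rule Bochner_Integration.integrable_bound[OF g]) (use R_bound in auto)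
  have q_meas[measurable]: "q \<in> borel_measurable borel"
    by (rule borel_measurable_LIMSEQ_real[where u="?R"]) (use q in auto)
  have q_bound: "\<bar>q x\<bar> \<le> \<bar>g x\<bar>" for x
    by (rule LIMSEQ_le_const2[OF tendsto_rabs[OF q]]) (use R_bound in auto)
  have qint: "integrable lborel q"
    by (rule Bochner_Integration.integrable_bound[OF g]) (use q_bound in auto)
  have Pf: "integrable lborel (\<lambda>x. P (f x))"
  proof (rule Bochner_Integration.integrable_bound[OF f])
    show "AE x in lborel. norm (P (f x)) \<le> norm (f x)"
      using P(2)[of _ 0] P(1) by auto
  qed measurable
  have R_lim: "(\<lambda>n. LINT x|lborel. \<bar>?R n x - q x\<bar>) \<longlonglongrightarrow> 0"
  proof -
    have "(\<lambda>n. LINT x|lborel. \<bar>?R n x - q x\<bar>) \<longlonglongrightarrow> (LINT x|(lborel :: 'a measure). 0)"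
    proof (rule integral_dominated_convergence[where w="\<lambda>x. 2 * \<bar>g x\<bar>"])
      show "AE x in lborel. (\<lambda>n. \<bar>?R n x - q x\<bar>) \<longlonglongrightarrow> 0"
        using tendsto_rabs_zero[OF LIM_zero[OF q]] by auto
      show "AE x in lborel. norm \<bar>?R n x - q x\<bar> \<le> 2 * \<bar>g x\<bar>" for n
      proof (rule AE_I2)
        fix x show "norm \<bar>?R n x - q x\<bar> \<le> 2 * \<bar>g x\<bar>"
          using R_bound[of x n] q_bound[of x] abs_triangle_ineq4[of "?R n x" "q x"]
          unfolding real_norm_def abs_idempotent by linarith
      qed
    qed (use g in auto)
    then show ?thesis by simp
  qed
  show ?thesis
  proof (rule has_weak_partial_if_tendsto_L1[OF Pf qint b t])
    show "(\<lambda>n. LINT x|lborel. \<bar>difference_quotient b (t n) (\<lambda>x. P (f x)) x - q x\<bar>) \<longlonglongrightarrow> 0"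
    proof (rule tendsto_sandwich[OF _ _ tendsto_const])
      show "(\<lambda>n. (LINT x|lborel. \<bar>difference_quotient b (t n) f x - g x\<bar>) + (LINT x|lborel. \<bar>?R n x - q x\<bar>)) \<longlonglongrightarrow> 0"
        using tendsto_add[OF weak_partial_tendsto_L1[OF fg b t] R_lim] by simp
      show "\<forall>\<^sub>F n in sequentially. (LINT x|lborel. \<bar>difference_quotient b (t n) (\<lambda>x. P (f x)) x - q x\<bar>)
        \<le> (LINT x|lborel. \<bar>difference_quotient b (t n) f x - g x\<bar>) + (LINT x|lborel. \<bar>?R n x - q x\<bar>)"
      proof (rule always_eventually, rule allI)
        fix n
        note int = integrable_difference_quotient[OF f, of b "t n"] integrable_difference_quotient[OF Pf, of b "t n"]
        have "(LINT x|lborel. \<bar>difference_quotient b (t n) (\<lambda>x. P (f x)) x - q x\<bar>)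
          \<le> (LINT x|lborel. \<bar>difference_quotient b (t n) f x - g x\<bar> + \<bar>?R n x - q x\<bar>)"
        proof (rule integral_mono)
          fix x
          have "\<bar>difference_quotient b (t n) (\<lambda>x. P (f x)) x - ?R n x\<bar>
             = \<bar>P (f (x + t n *\<^sub>R b)) - P (f x + t n * g x)\<bar> / \<bar>t n\<bar>"
            unfolding difference_quotient_def diff_divide_distrib[symmetric] abs_divide by simp
          also have "\<dots> \<le> \<bar>f (x + t n *\<^sub>R b) - (f x + t n * g x)\<bar> / \<bar>t n\<bar>"
            by (intro divide_right_mono P) simp
          also have "\<dots> = \<bar>difference_quotient b (t n) f x - g x\<bar>"
            unfolding difference_quotient_def abs_divide[symmetric] using t(2)[of n]
            by (simp add: diff_divide_distrib add_divide_distrib)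
          finally show "\<bar>difference_quotient b (t n) (\<lambda>x. P (f x)) x - q x\<bar>
              \<le> \<bar>difference_quotient b (t n) f x - g x\<bar> + \<bar>?R n x - q x\<bar>" by linarith
        qed (use int g R qint in \<open>auto intro!: integrable_abs Bochner_Integration.integrable_diff Bochner_Integration.integrable_add\<close>)
        also have "\<dots> = (LINT x|lborel. \<bar>difference_quotient b (t n) f x - g x\<bar>) + (LINT x|lborel. \<bar>?R n x - q x\<bar>)"
          using int g R qint
          by (intro Bochner_Integration.integral_add integrable_abs Bochner_Integration.integrable_diff)
        finally show "(LINT x|lborel. \<bar>difference_quotient b (t n) (\<lambda>x. P (f x)) x - q x\<bar>)
          \<le> (LINT x|lborel. \<bar>difference_quotient b (t n) f x - g x\<bar>) + (LINT x|lborel. \<bar>?R n x - q x\<bar>)" .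
      qed
    qed simp
  qed
qed

text \<open>Truncation at height \<open>c\<close>, shifted by a constant so that \<open>0\<close> is fixed and integrability
  is preserved also for negative \<open>c\<close>.\<close>
definition cut_above :: "real \<Rightarrow> real \<Rightarrow> real" where
  "cut_above c s = min s c - min 0 c"

text \<open>On \<open>{f = c}\<close> the truncation has different one-sided derivatives.  Positive step sizes
  produce the first formula and negative ones the second.\<close>
lemma has_weak_partial_cut_above_one_sided:
  fixes f :: "'a::euclidean_space \<Rightarrow> real"
  assumes fg: "has_weak_partial b f g" and b: "b \<in> Basis"
  shows "has_weak_partial b (\<lambda>x. cut_above c (f x))
      (\<lambda>x. if f x < c then g x else if f x = c then min (g x) 0 else 0)" (is ?pos)
    and "has_weak_partial b (\<lambda>x. cut_above c (f x))
      (\<lambda>x. if f x < c then g x else if f x = c then max (g x) 0 else 0)" (is ?neg)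
proof -
  have P: "cut_above c 0 = 0" "\<bar>cut_above c r - cut_above c s\<bar> \<le> \<bar>r - s\<bar>" for r s
    by (auto simp: cut_above_def)
  have lim: "(\<lambda>n. (cut_above c (y + t n * z) - cut_above c y) / t n)
      \<longlonglongrightarrow> (if y < c then z else if y = c then w else 0)"
    if t: "t \<longlonglongrightarrow> 0" "\<And>n. t n \<noteq> 0" and w: "\<And>n. min (t n * z) 0 = t n * w"
    for t :: "nat \<Rightarrow> real" and y z w
  proof (rule tendsto_eventually)
    have near: "(\<lambda>n. y + t n * z) \<longlonglongrightarrow> y"
      using t(1) by (auto intro!: tendsto_eq_intros)
    consider "y < c" | "y = c" | "c < y" by linarith
    then show "\<forall>\<^sub>F n in sequentially. (cut_above c (y + t n * z) - cut_above c y) / t n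
        = (if y < c then z else if y = c then w else 0)"
    proof cases
      case 1
      from order_tendstoD(2)[OF near 1] show ?thesis
        by (rule eventually_mono) (use 1 t(2) in \<open>simp add: cut_above_def\<close>)
    next
      case 2
      have "(cut_above c (y + t n * z) - cut_above c y) / t n = w" for n
      proof -
        have "min (y + t n * z) y - y = min (t n * z) 0" by auto
        then show ?thesis using w[of n] t(2)[of n] 2 by (simp add: cut_above_def)
      qed
      then show ?thesis using 2 by simp
    next
      case 3
      from order_tendstoD(1)[OF near 3] show ?thesis
        by (rule eventually_mono) (use 3 in \<open>simp add: cut_above_def\<close>)
    qed
  qed
  have min_scale: "min (k * z) 0 = k * min z 0" "min (- k * z) 0 = - k * max z 0"
    if "k > 0" for k z :: real
    using that by (auto simp: min_def max_def mult_le_0_iff zero_le_mult_iff)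
  have t: "(\<lambda>n. 1 / real (Suc n)) \<longlonglongrightarrow> 0"
    using LIMSEQ_inverse_real_of_nat by (simp add: inverse_eq_divide)
  show ?pos
  proof (rule has_weak_partial_nonexpansive[OF fg b t _ P lim[OF t]])
    show "min (1 / real (Suc n) * z) 0 = 1 / real (Suc n) * min z 0" for n z
      by (rule min_scale) simp
  qed simp_all
  have t': "(\<lambda>n. - (1 / real (Suc n))) \<longlonglongrightarrow> 0"
    using tendsto_minus[OF t] by simp
  show ?neg
  proof (rule has_weak_partial_nonexpansive[OF fg b t' _ P lim[OF t']])
    show "min (- (1 / real (Suc n)) * z) 0 = - (1 / real (Suc n)) * max z 0" for n z
      by (rule min_scale) simp
  qed simp_all
qed

text \<open>Uniqueness of the weak gradient makes the two one-sided formulas agree almost everywhere,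
  so \<open>min (G x \<bullet> b) 0 = max (G x \<bullet> b) 0\<close> and hence \<open>G x = 0\<close> where \<open>f x = c\<close>.\<close>
theorem weak_gradient_cut_above:
  fixes f :: "'a::euclidean_space \<Rightarrow> real"
  assumes fG: "has_weak_gradient f G"
  shows "AE x in lborel. f x = c \<longrightarrow> G x = 0"
    and "has_weak_gradient (\<lambda>x. cut_above c (f x)) (\<lambda>x. indicator {x. f x \<le> c} x *\<^sub>R G x)"
proof -
  have [measurable]: "f \<in> borel_measurable borel" "G \<in> borel_measurable borel"
    using fG by (auto simp: has_weak_gradient_def)
  define H where "H m x = (\<Sum>b\<in>Basis.
    (if f x < c then G x \<bullet> b else if f x = c then m (G x \<bullet> b) 0 else 0) *\<^sub>R b)"
    for m :: "real \<Rightarrow> real \<Rightarrow> real" and x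
  have Hb: "H m x \<bullet> b = (if f x < c then G x \<bullet> b else if f x = c then m (G x \<bullet> b) 0 else 0)"
    if "b \<in> Basis" for m x b
    using that unfolding H_def by simp
  have wg: "has_weak_gradient (\<lambda>x. cut_above c (f x)) (H min)"
    "has_weak_gradient (\<lambda>x. cut_above c (f x)) (H max)"
    using fG unfolding has_weak_gradient_iff_partials
    by (auto simp: Hb has_weak_partial_cut_above_one_sided)
  have "AE x in lborel. H min x = H max x"
    by (rule weak_gradient_unique[OF wg])
  then show null: "AE x in lborel. f x = c \<longrightarrow> G x = 0"
  proof (rule eventually_mono, intro impI)
    fix x assume eq: "H min x = H max x" and "f x = c"
    show "G x = 0"
    proof (rule euclidean_eqI)
      fix b :: 'a assume b: "b \<in> Basis"
      show "G x \<bullet> b = 0 \<bullet> b"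
        using arg_cong[OF eq, of "\<lambda>v. v \<bullet> b"] \<open>f x = c\<close>
        unfolding Hb[OF b] by (simp add: min_def max_def split: if_splits)
    qed
  qed
  show "has_weak_gradient (\<lambda>x. cut_above c (f x)) (\<lambda>x. indicator {x. f x \<le> c} x *\<^sub>R G x)"
  proof (rule has_weak_gradient_cong_AE[OF wg(1)])
    show "AE x in lborel. H min x = indicator {x. f x \<le> c} x *\<^sub>R G x"
      using null
    proof eventually_elim
      case (elim x)
      show ?case
        by (rule euclidean_eqI) (use elim in \<open>auto simp: Hb indicator_def\<close>)
    qed
    show "(\<lambda>x. cut_above c (f x)) \<in> borel_measurable borel"
      unfolding cut_above_def by measurable
  qed simp_all
qed

section \<open>Layers of equal mass\<close>

lemma integrable_indicator_norm:
  fixes G :: "'a::euclidean_space \<Rightarrow> 'b::{banach, second_countable_topology}"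
  assumes "integrable lborel G" "A \<in> sets borel"
  shows "integrable lborel (\<lambda>x. indicator A x * norm (G x))"
  using integrable_mult_indicator[of A lborel "\<lambda>x. norm (G x)"] assms by simp

text \<open>The mass of the gradient on \<open>{f \<le> c}\<close> has no jumps in \<open>c\<close>, as the gradient vanishes on
  level sets; it runs from \<open>0\<close> to the full mass, and the intermediate value theorem applies.\<close>
lemma sublevel_mass_attains:
  fixes f :: "'a::euclidean_space \<Rightarrow> real"
  assumes fG: "has_weak_gradient f G" and r: "0 < r" "r < (LINT x|lborel. norm (G x))"
  obtains c where "(LINT x|lborel. indicator {x. f x \<le> c} x * norm (G x)) = r"
proof -
  have G: "integrable lborel G" using fG by (auto simp: has_weak_gradient_def)
  have [measurable]: "f \<in> borel_measurable borel" "G \<in> borel_measurable borel"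
    using fG by (auto simp: has_weak_gradient_def)
  define C where "C c = (LINT x|lborel. indicator {x. f x \<le> c} x * norm (G x))" for c
  have lim: "(\<lambda>n. C (s n)) \<longlonglongrightarrow> (LINT x|lborel. z x)"
    if "AE x in lborel. (\<lambda>n. indicator {x. f x \<le> s n} x * norm (G x)) \<longlonglongrightarrow> z x"
      and [measurable]: "z \<in> borel_measurable borel" for s :: "nat \<Rightarrow> real" and z
    unfolding C_def
    by (rule integral_dominated_convergence[where w="\<lambda>x. norm (G x)"])
      (use G that in \<open>auto simp: indicator_def\<close>)
  have cont: "continuous_on UNIV C"
    unfolding continuous_on_sequentially comp_def
  proof (intro allI ballI impI, elim conjE)
    fix s :: "nat \<Rightarrow> real" and c assume s: "s \<longlonglongrightarrow> c"
    show "(\<lambda>n. C (s n)) \<longlonglongrightarrow> C c"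
      unfolding C_def[of c]
    proof (rule lim)
      show "AE x in lborel. (\<lambda>n. indicator {x. f x \<le> s n} x * norm (G x)) \<longlonglongrightarrow> indicator {x. f x \<le> c} x * norm (G x)"
        using weak_gradient_cut_above(1)[OF fG, of c]
      proof eventually_elim
        case (elim x)
        consider "f x < c" | "f x = c" | "c < f x" by linarith
        then show ?case
        proof cases
          case 1
          from order_tendstoD(1)[OF s this] show ?thesis
            by (intro tendsto_eventually, elim eventually_mono) (use 1 in simp)
        next
          case 2
          then show ?thesis using elim by simp
        next
          case 3
          from order_tendstoD(2)[OF s this] show ?thesis
            by (intro tendsto_eventually, elim eventually_mono) (use 3 in simp)
        qed
      qed
    qed measurable
  qed
  have "(\<lambda>n. C (- real n)) \<longlonglongrightarrow> (LINT x|(lborel :: 'a measure). 0)"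
  proof (rule lim, rule AE_I2, rule tendsto_eventually)
    fix x
    obtain N :: nat where "- f x < real N" using reals_Archimedean2 by blast
    then show "\<forall>\<^sub>F n in sequentially. indicator {x. f x \<le> - real n} x * norm (G x) = 0"
      by (intro eventually_sequentiallyI[of N]) (auto simp: indicator_def)
  qed simp
  then have "(\<lambda>n. C (- real n)) \<longlonglongrightarrow> 0" by simp
  from eventually_happens'[OF sequentially_bot order_tendstoD(2)[OF this r(1)]]
  obtain a where a: "C a < r" by blast
  have "(\<lambda>n. C (real n)) \<longlonglongrightarrow> (LINT x|lborel. norm (G x))"
  proof (rule lim, rule AE_I2, rule tendsto_eventually)
    fix x
    obtain N :: nat where "f x < real N" using reals_Archimedean2 by blast
    then show "\<forall>\<^sub>F n in sequentially. indicator {x. f x \<le> real n} x * norm (G x) = norm (G x)"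
      by (intro eventually_sequentiallyI[of N]) (auto simp: indicator_def)
  qed simp
  from eventually_happens'[OF sequentially_bot order_tendstoD(1)[OF this r(2)]]
  obtain b where b: "r < C b" by blast
  have "a \<le> b"
  proof (rule ccontr)
    assume "\<not> a \<le> b"
    then have "C b \<le> C a"
      unfolding C_def by (intro integral_mono integrable_indicator_norm G) (auto simp: indicator_def)
    then show False using a b by simp
  qed
  then obtain c where "C c = r"
    using IVT'[of C a r b] continuous_on_subset[OF cont, of "{a..b}"] a b by auto
  then show thesis using that unfolding C_def by blast
qed

text \<open>The increasing chain of truncations \<open>u k\<close> whose successive differences are the layers.
  Its ends are taken to be \<open>0\<close> and \<open>f\<close> themselves, which avoids infinite levels.\<close>
proposition gradient_layers:
  fixes f :: "'a::euclidean_space \<Rightarrow> real"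
  assumes fG: "has_weak_gradient f G" and pos: "0 < (LINT x|lborel. norm (G x))" and N: "N > 0"
  obtains u E where "u 0 = (\<lambda>x. 0)" "u N = f"
    "\<And>k. k \<le> N \<Longrightarrow> has_weak_gradient (u k) (\<lambda>x. indicator (E k) x *\<^sub>R G x)"
    "\<And>k. k \<le> N \<Longrightarrow> E k \<in> sets borel"
    "\<And>k. k \<le> N \<Longrightarrow> (LINT x|lborel. indicator (E k) x * norm (G x)) = real k / real N * (LINT x|lborel. norm (G x))"
    "\<And>k l. k \<le> l \<Longrightarrow> l \<le> N \<Longrightarrow> E k \<subseteq> E l"
proof -
  let ?m = "LINT x|lborel. norm (G x)"
  have G: "integrable lborel G" using fG by (auto simp: has_weak_gradient_def)
  have [measurable]: "f \<in> borel_measurable borel" "G \<in> borel_measurable borel"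
    using fG by (auto simp: has_weak_gradient_def)
  have "\<exists>c. (LINT x|lborel. indicator {x. f x \<le> c} x * norm (G x)) = real k / real N * ?m" if "0 < k" "k < N" for k
  proof (rule sublevel_mass_attains[OF fG])
    show "0 < real k / real N * ?m" using that pos by simp
    have "real k / real N < 1" using that by simp
    from mult_strict_right_mono[OF this pos] show "real k / real N * ?m < ?m" by simp
  qed blast
  then obtain c where c: "\<And>k. 0 < k \<Longrightarrow> k < N \<Longrightarrow>
      (LINT x|lborel. indicator {x. f x \<le> c k} x * norm (G x)) = real k / real N * ?m"
    by metis
  define E where "E k = (if k = 0 then {} else if k = N then UNIV else {x. f x \<le> c k})" for k
  define u where "u k = (if k = 0 then (\<lambda>x. 0) else if k = N then f else (\<lambda>x. cut_above (c k) (f x)))" for k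
  show thesis
  proof (rule that)
    show "u 0 = (\<lambda>x. 0)" "u N = f" using N by (simp_all add: u_def)
    show "has_weak_gradient (u k) (\<lambda>x. indicator (E k) x *\<^sub>R G x)" if "k \<le> N" for k
      using weak_gradient_cut_above(2)[OF fG, of "c k"] fG
      by (auto simp: u_def E_def has_weak_gradient_zero)
    show "E k \<in> sets borel" if "k \<le> N" for k
    proof -
      have "{x. f x \<le> c k} \<in> sets borel" by measurable
      then show ?thesis by (simp add: E_def)
    qed
    show mass: "(LINT x|lborel. indicator (E k) x * norm (G x)) = real k / real N * ?m" if "k \<le> N" for k
      using c[of k] that N by (auto simp: E_def)
    show "E k \<subseteq> E l" if "k \<le> l" "l \<le> N" for k l
    proof (cases "0 < k \<and> k < l \<and> l < N")
      case True
      have "c k \<le> c l"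
      proof (rule ccontr)
        assume "\<not> c k \<le> c l"
        then have "(LINT x|lborel. indicator {x. f x \<le> c l} x * norm (G x))
            \<le> (LINT x|lborel. indicator {x. f x \<le> c k} x * norm (G x))"
          by (intro integral_mono integrable_indicator_norm G) (auto simp: indicator_def)
        then have "real l / real N * ?m \<le> real k / real N * ?m"
          using c True by simp
        then have "real l \<le> real k" using pos N by (simp add: divide_simps)
        then show False using True by simp
      qed
      then show ?thesis using True by (auto simp: E_def)
    next
      case False
      then show ?thesis using that by (auto simp: E_def)
    qed
  qed
qed

section \<open>Gradients of elements of the quotient\<close>

text \<open>Working with gradients, which are determined up to null sets, instead of representatives
  keeps the choice of a representative out of the norm estimates.\<close>
definition has_gradient :: "sobolev \<Rightarrow> (real^2 \<Rightarrow> real^2) \<Rightarrow> bool" where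
  "has_gradient y F \<longleftrightarrow> (\<exists>f. has_weak_gradient f F \<and> y = abs_sobolev f)"

lemma sobolev_rel_self: "has_weak_gradient f F \<Longrightarrow> sobolev_rel f f"
  by (rule sobolev_rel_refl) (auto simp: W11_def)

lemma has_gradient_integrable: "has_gradient y F \<Longrightarrow> integrable lborel F"
  by (auto simp: has_gradient_def has_weak_gradient_def)

lemma ex_has_gradient: "\<exists>F. has_gradient y F"
proof (induction y rule: sobolev.abs_induct)
  case (1 f)
  then show ?case unfolding has_gradient_def by (auto simp: sobolev_rel_def W11_def)
qed

lemma norm_has_gradient: "has_gradient y F \<Longrightarrow> norm y = (LINT x|lborel. norm (F x))"
  by (auto simp: has_gradient_def norm_sobolev.abs_eq sobolev_rel_self sobolev_norm_eq)

lemma has_gradient_add: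
  assumes "has_gradient y F" "has_gradient z G"
  shows "has_gradient (y + z) (\<lambda>x. F x + G x)"
proof -
  obtain f g where f: "has_weak_gradient f F" "y = abs_sobolev f"
    and g: "has_weak_gradient g G" "z = abs_sobolev g"
    using assms unfolding has_gradient_def by blast
  have "y + z = abs_sobolev (\<lambda>x. f x + g x)"
    unfolding f(2) g(2) by (rule plus_sobolev.abs_eq[OF sobolev_rel_self[OF f(1)] sobolev_rel_self[OF g(1)]])
  then show ?thesis
    using has_weak_gradient_add[OF f(1) g(1)] unfolding has_gradient_def by blast
qed

lemma has_gradient_scaleR:
  assumes "has_gradient y F"
  shows "has_gradient (c *\<^sub>R y) (\<lambda>x. c *\<^sub>R F x)"
proof -
  obtain f where f: "has_weak_gradient f F" "y = abs_sobolev f"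
    using assms unfolding has_gradient_def by blast
  have "c *\<^sub>R y = abs_sobolev (\<lambda>x. c * f x)"
    unfolding f(2) by (rule scaleR_sobolev.abs_eq[OF sobolev_rel_self[OF f(1)]])
  then show ?thesis
    using has_weak_gradient_scale[OF f(1)] unfolding has_gradient_def by blast
qed

lemma has_gradient_diff:
  assumes "has_gradient y F" "has_gradient z G"
  shows "has_gradient (y - z) (\<lambda>x. F x - G x)"
  using has_gradient_add[OF assms(1) has_gradient_scaleR[OF assms(2), of "-1"]] by simp

lemma sobolev_layers:
  assumes x: "x \<noteq> 0" and G: "has_gradient x G" and N: "N > 0"
  obtains y S where "x = (\<Sum>k<N. y k)"
    "\<And>k. k < N \<Longrightarrow> has_gradient (y k) (\<lambda>p. indicator (S k) p *\<^sub>R G p)"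
    "\<And>k. k < N \<Longrightarrow> norm (y k) = norm x / real N"
    "\<And>k. k < N \<Longrightarrow> S k \<in> sets borel"
    "disjoint_family_on S {..<N}"
proof -
  obtain f where f: "has_weak_gradient f G" "x = abs_sobolev f"
    using G unfolding has_gradient_def by blast
  have nx: "norm x = (LINT p|lborel. norm (G p))" by (rule norm_has_gradient[OF G])
  then have pos: "0 < (LINT p|lborel. norm (G p))" using x by (metis zero_less_norm_iff)
  obtain u E where
    u0: "u 0 = (\<lambda>x. 0)" and uN: "u N = f" and
    u: "\<And>k. k \<le> N \<Longrightarrow> has_weak_gradient (u k) (\<lambda>p. indicator (E k) p *\<^sub>R G p)" and
    E: "\<And>k. k \<le> N \<Longrightarrow> E k \<in> sets borel" and
    mass: "\<And>k. k \<le> N \<Longrightarrow> (LINT p|lborel. indicator (E k) p * norm (G p)) = real k / real N * (LINT p|lborel. norm (G p))" and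
    mono: "\<And>k l. k \<le> l \<Longrightarrow> l \<le> N \<Longrightarrow> E k \<subseteq> E l"
    using gradient_layers[OF f(1) pos N] by blast
  define y where "y k = abs_sobolev (u (Suc k)) - abs_sobolev (u k)" for k
  define S where "S k = E (Suc k) - E k" for k
  have ind: "indicator (S k) p = indicator (E (Suc k)) p - (indicator (E k) p :: real)" if "k < N" for k p
    using mono[of k "Suc k"] that by (auto simp: S_def indicator_def)
  have grad: "has_gradient (y k) (\<lambda>p. indicator (S k) p *\<^sub>R G p)" if "k < N" for k
  proof -
    have "has_gradient (y k) (\<lambda>p. indicator (E (Suc k)) p *\<^sub>R G p - indicator (E k) p *\<^sub>R G p)"
      unfolding y_def using u[of k] u[of "Suc k"] that
      by (intro has_gradient_diff) (auto simp: has_gradient_def)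
    then show ?thesis by (simp add: ind[OF that] scaleR_left_diff_distrib)
  qed
  show thesis
  proof (rule that[of y S])
    have "abs_sobolev (u 0) = 0" unfolding u0 by (simp add: zero_sobolev_def)
    then show "x = (\<Sum>k<N. y k)"
      unfolding y_def sum_lessThan_telescope[of "\<lambda>k. abs_sobolev (u k)" N] by (simp add: f(2) uN)
    show "norm (y k) = norm x / real N" if "k < N" for k
    proof -
      note G' = has_gradient_integrable[OF G]
      have "norm (y k) = (LINT p|lborel. indicator (E (Suc k)) p * norm (G p) - indicator (E k) p * norm (G p))"
        unfolding norm_has_gradient[OF grad[OF that]]
        by (rule Bochner_Integration.integral_cong) (auto simp: left_diff_distrib[symmetric] ind[OF that, symmetric])
      also have "\<dots> = real (Suc k) / real N * norm x - real k / real N * norm x"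
        using that by (subst Bochner_Integration.integral_diff)
          (auto intro!: integrable_indicator_norm G' E simp: mass nx)
      also have "\<dots> = norm x / real N" by (simp add: distrib_right add_divide_distrib)
      finally show ?thesis .
    qed
    show "S k \<in> sets borel" if "k < N" for k
      using E[of k] E[of "Suc k"] that by (auto simp: S_def)
    show "disjoint_family_on S {..<N}"
      unfolding disjoint_family_on_def
    proof (intro ballI impI)
      have *: "S i \<inter> S j = {}" if "i < j" "j < N" for i j
        using mono[of "Suc i" j] that by (auto simp: S_def)
      fix i j assume "i \<in> {..<N}" "j \<in> {..<N}" "i \<noteq> j"
      then show "S i \<inter> S j = {}" using *[of i j] *[of j i] by (cases "i < j") auto
    qed
  qed (rule grad)
qed

text \<open>Off \<open>S\<close> the norms of the gradients add up exactly, and on \<open>S\<close> the reverse triangle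
  inequality loses at most twice the norm of \<open>H\<close>.\<close>
lemma norm_add_almost_disjoint:
  assumes y: "has_gradient y (\<lambda>p. indicator S p *\<^sub>R G p)" and w: "has_gradient w H" and S: "S \<in> sets borel"
  shows "norm y + norm w - 2 * (LINT p|lborel. indicator S p * norm (H p)) \<le> norm (y + w)"
proof -
  note iy = has_gradient_integrable[OF y] and iw = has_gradient_integrable[OF w]
  note iS = integrable_indicator_norm[OF iw S]
  have "norm y + norm w - 2 * (LINT p|lborel. indicator S p * norm (H p))
      = (LINT p|lborel. norm (indicator S p *\<^sub>R G p) + norm (H p) - 2 * (indicator S p * norm (H p)))"
    unfolding norm_has_gradient[OF y] norm_has_gradient[OF w]
    using integrable_norm[OF iy] integrable_norm[OF iw] iS by simp
  also have "\<dots> \<le> (LINT p|lborel. norm (indicator S p *\<^sub>R G p + H p))"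
  proof (rule integral_mono)
    fix p
    show "norm (indicator S p *\<^sub>R G p) + norm (H p) - 2 * (indicator S p * norm (H p))
        \<le> norm (indicator S p *\<^sub>R G p + H p)"
      using norm_diff_ineq[of "G p" "H p"] by (cases "p \<in> S") auto
  qed (use integrable_norm[OF iy] integrable_norm[OF iw] iS iy iw in
      \<open>auto intro!: integrable_norm Bochner_Integration.integrable_add Bochner_Integration.integrable_diff\<close>)
  also have "\<dots> = norm (y + w)"
    using norm_has_gradient[OF has_gradient_add[OF y w]] by simp
  finally show ?thesis .
qed

text \<open>The heart of the matter: every slice \<open>{y. \<xi> y > K * norm y}\<close> that is not empty contains
  unit vectors almost orthogonal, in the sense of \<open>\<ell>\<^sup>1\<close>, to a given \<open>w\<close>.  If all layers of \<open>x\<close>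
  outside the few bad ones violated the slice inequality, then \<open>\<xi> x - K * norm x\<close> would be
  bounded by the contribution of the bad layers, which is \<open>O(1 / N)\<close>.\<close>
proposition slice_almost_l1_orthogonal:
  fixes \<xi> :: "sobolev \<Rightarrow> real" and w :: sobolev
  assumes lin: "linear \<xi>" and M: "\<And>y. \<bar>\<xi> y\<bar> \<le> M * norm y"
    and x: "\<xi> x > K * norm x" and \<eta>: "\<eta> > 0"
  obtains y where "norm y = 1" "\<xi> y > K" "\<And>a. norm (y + a *\<^sub>R w) \<ge> 1 + \<bar>a\<bar> * (norm w - \<eta>)"
proof -
  have x0: "x \<noteq> 0" using x M[of 0] by auto
  define L where "L = M + \<bar>K\<bar>"
  define \<delta> where "\<delta> = \<xi> x - K * norm x"
  have \<delta>: "\<delta> > 0" using x by (simp add: \<delta>_def)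
  have "0 \<le> M * norm x" using M[of x] by linarith
  then have L: "L \<ge> 0" using x0 by (simp add: L_def zero_le_mult_iff)
  obtain N :: nat where N: "2 * norm w / \<eta> * L * norm x / \<delta> < real N"
    using reals_Archimedean2 by blast
  have "0 \<le> 2 * norm w / \<eta> * L * norm x / \<delta>" using L \<delta> \<eta> by simp
  then have N0: "N > 0" using N by (cases N) auto
  obtain G where G: "has_gradient x G" using ex_has_gradient by blast
  obtain H where H: "has_gradient w H" using ex_has_gradient by blast
  note iH = has_gradient_integrable[OF H]
  obtain y S where sum: "x = (\<Sum>k<N. y k)"
    and grad: "\<And>k. k < N \<Longrightarrow> has_gradient (y k) (\<lambda>p. indicator (S k) p *\<^sub>R G p)"
    and norm: "\<And>k. k < N \<Longrightarrow> norm (y k) = norm x / real N"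
    and S: "\<And>k. k < N \<Longrightarrow> S k \<in> sets borel" and disj: "disjoint_family_on S {..<N}"
    using sobolev_layers[OF x0 G N0] by blast
  define h where "h k = (LINT p|lborel. indicator (S k) p * norm (H p))" for k
  have h0: "h k \<ge> 0" for k unfolding h_def by (intro Bochner_Integration.integral_nonneg) simp
  \<comment> \<open>The sets \<open>S k\<close> are disjoint, so few of them can carry much of the gradient of \<open>w\<close>.\<close>
  define bad where "bad = {k. k < N \<and> h k > \<eta> / 2}"
  have fin: "finite bad" "bad \<subseteq> {..<N}" by (auto simp: bad_def)
  have "real (card bad) * (\<eta> / 2) \<le> (\<Sum>k\<in>bad. h k)"
    by (subst sum_constant[symmetric], intro sum_mono) (auto simp: bad_def)
  also have "\<dots> \<le> (\<Sum>k<N. h k)"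
    using fin h0 by (intro sum_mono2) auto
  also have "\<dots> = (LINT p|lborel. (\<Sum>k<N. indicator (S k) p * norm (H p)))"
    unfolding h_def by (intro Bochner_Integration.integral_sum[symmetric] integrable_indicator_norm iH S) simp
  also have "\<dots> \<le> (LINT p|lborel. norm (H p))"
  proof (rule integral_mono)
    fix p
    have "(\<Sum>k<N. indicator (S k) p * norm (H p)) = (\<Sum>k<N. indicator (S k) p :: real) * norm (H p)"
      by (simp add: sum_distrib_right)
    also have "(\<Sum>k<N. indicator (S k) p :: real) = indicator (\<Union>k<N. S k) p"
      by (rule indicator_UN_disjoint[symmetric]) (use disj in auto)
    also have "\<dots> * norm (H p) \<le> norm (H p)"
      by (intro mult_left_le_one_le) (auto simp: indicator_def)
    finally show "(\<Sum>k<N. indicator (S k) p * norm (H p)) \<le> norm (H p)" .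
  next
    show "integrable lborel (\<lambda>p. \<Sum>k<N. indicator (S k) p * norm (H p))"
      by (intro Bochner_Integration.integrable_sum integrable_indicator_norm iH S) simp
  qed (intro integrable_norm iH)
  finally have card: "real (card bad) \<le> 2 * norm w / \<eta>"
    using norm_has_gradient[OF H] \<eta> by (simp add: field_simps)
  have "\<exists>k<N. k \<notin> bad \<and> \<xi> (y k) > K * norm (y k)"
  proof (rule ccontr)
    assume "\<not> ?thesis"
    then have good: "\<xi> (y k) - K * norm (y k) \<le> 0" if "k < N" "k \<notin> bad" for k
      using that by force
    have "\<delta> = (\<Sum>k<N. \<xi> (y k) - K * norm (y k))"
      using N0 arg_cong[OF sum, of \<xi>] by (simp add: \<delta>_def linear_sum[OF lin] sum_subtractf norm)
    also have "\<dots> \<le> (\<Sum>k<N. if k \<in> bad then L * (norm x / real N) else 0)"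
    proof (rule sum_mono)
      fix k assume "k \<in> {..<N}"
      then have k: "k < N" by simp
      have "- K * norm (y k) \<le> \<bar>K\<bar> * norm (y k)" by (intro mult_right_mono) auto
      then have "\<xi> (y k) - K * norm (y k) \<le> L * norm (y k)"
        using M[of "y k"] by (simp add: L_def algebra_simps)
      then show "\<xi> (y k) - K * norm (y k) \<le> (if k \<in> bad then L * (norm x / real N) else 0)"
        using good[OF k] norm[OF k] by auto
    qed
    also have "\<dots> = real (card bad) * (L * (norm x / real N))"
      using fin by (simp add: sum.If_cases Int_absorb1)
    also have "\<dots> \<le> 2 * norm w / \<eta> * (L * (norm x / real N))"
      using card L by (intro mult_right_mono) auto
    also have "\<dots> = 2 * norm w / \<eta> * L * norm x / real N" by simp
    also have "\<dots> < \<delta>"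
      using N N0 \<delta> unfolding pos_divide_less_eq[OF \<delta>]
      by (subst pos_divide_less_eq) (simp_all only: of_nat_0_less_iff mult.commute)
    finally show False by simp
  qed
  then obtain k where k: "k < N" "k \<notin> bad" "\<xi> (y k) > K * norm (y k)" by blast
  define r where "r = norm (y k)"
  have r: "r > 0" using norm[OF k(1)] x0 N0 by (simp add: r_def)
  have hk: "h k \<le> \<eta> / 2" using k(1,2) by (simp add: bad_def)
  show thesis
  proof (rule that[of "(1 / r) *\<^sub>R y k"])
    show n1: "norm ((1 / r) *\<^sub>R y k) = 1" using r by (simp add: r_def)
    show "K < \<xi> ((1 / r) *\<^sub>R y k)"
      using k(3) r by (simp add: linear_scale[OF lin] r_def[symmetric] field_simps)
    fix a
    have "has_gradient ((1 / r) *\<^sub>R y k) (\<lambda>p. indicator (S k) p *\<^sub>R (1 / r) *\<^sub>R G p)"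
      using has_gradient_scaleR[OF grad[OF k(1)], of "1 / r"] by (simp add: mult.commute)
    from norm_add_almost_disjoint[OF this has_gradient_scaleR[OF H, of a] S[OF k(1)]]
    have "1 + \<bar>a\<bar> * norm w - 2 * (LINT p|lborel. \<bar>a\<bar> * (indicator (S k) p * norm (H p)))
        \<le> norm ((1 / r) *\<^sub>R y k + a *\<^sub>R w)"
      unfolding n1 by (simp add: mult.left_commute)
    then have "1 + \<bar>a\<bar> * norm w - 2 * (\<bar>a\<bar> * h k) \<le> norm ((1 / r) *\<^sub>R y k + a *\<^sub>R w)"
      by (simp add: h_def)
    moreover have "\<bar>a\<bar> * h k \<le> \<bar>a\<bar> * (\<eta> / 2)" using hk by (intro mult_left_mono) auto
    ultimately show "1 + \<bar>a\<bar> * (norm w - \<eta>) \<le> norm ((1 / r) *\<^sub>R y k + a *\<^sub>R w)"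
      by (simp add: algebra_simps)
  qed
qed

section \<open>The Daugavet property\<close>

lemma rank_one_representation:
  fixes T :: "'a::real_normed_vector \<Rightarrow> 'b::real_normed_vector"
  assumes T: "linear T" and rank: "dim (range T) = 1"
  obtains \<xi> e where "linear \<xi>" "norm e = 1" "\<And>x. T x = \<xi> x *\<^sub>R e"
proof -
  obtain B where B: "B \<subseteq> range T" "independent B" "range T \<subseteq> span B" "card B = dim (range T)"
    using basis_exists by blast
  then obtain v where v: "B = {v}" using rank card_1_singletonE by metis
  then have v0: "v \<noteq> 0" using B(2) dependent_zero by auto
  define e where "e = v /\<^sub>R norm v"
  have e: "norm e = 1" using v0 by (simp add: e_def)
  have "\<exists>c. T x = c *\<^sub>R e" for x
  proof -
    have "T x \<in> span {v}" using B(3) v by auto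
    then obtain c where "T x = c *\<^sub>R v" by (auto simp: span_singleton)
    then have "T x = (c * norm v) *\<^sub>R e" using v0 by (simp add: e_def)
    then show ?thesis by blast
  qed
  then obtain \<xi> where \<xi>: "\<And>x. T x = \<xi> x *\<^sub>R e" by metis
  have inj: "c *\<^sub>R e = d *\<^sub>R e \<longleftrightarrow> c = d" for c d using e by auto
  have "linear \<xi>"
  proof (rule linearI)
    show "\<xi> (x + y) = \<xi> x + \<xi> y" for x y
      using linear_add[OF T, of x y] unfolding \<xi> scaleR_left_distrib[symmetric] inj .
    show "\<xi> (c *\<^sub>R x) = c *\<^sub>R \<xi> x" for c x
      using linear_scale[OF T, of c x] unfolding \<xi> scaleR_scaleR inj by simp
  qed
  with e \<xi> show thesis using that by blast
qed

theorem theorem3p1: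
  shows "daugavet_property TYPE(sobolev)"
  unfolding daugavet_property_def
proof (intro allI impI, elim conjE)
  fix T :: "sobolev \<Rightarrow> sobolev"
  assume T: "bounded_linear T" and rank: "dim (range T) = 1"
  obtain \<xi> e where lin: "linear \<xi>" and e: "norm e = 1" and T_eq: "\<And>x. T x = \<xi> x *\<^sub>R e"
    using rank_one_representation[OF bounded_linear.linear[OF T] rank] by blast
  let ?M = "onorm T"
  have IT: "bounded_linear (\<lambda>x. x + T x)"
    by (intro bounded_linear_add bounded_linear_ident T)
  have \<xi>_norm: "norm (T x) = \<bar>\<xi> x\<bar>" for x using T_eq e by simp
  have M: "\<bar>\<xi> x\<bar> \<le> ?M * norm x" for x
    using onorm[OF T, of x] \<xi>_norm by simp
  have Mpos: "?M > 0"
  proof -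
    have "\<not> (\<forall>x. T x = 0)"
    proof
      assume "\<forall>x. T x = 0"
      then have "range T = {0}" by auto
      moreover have "dim {0 :: sobolev} = 0" by (rule dim_unique[of "{}"]) (auto simp: independent_empty)
      ultimately show False using rank by simp
    qed
    then show ?thesis using onorm_pos_lt[OF T] by blast
  qed
  show "onorm (\<lambda>x. x + T x) = 1 + ?M"
  proof (rule antisym)
    have "onorm (\<lambda>x. x + T x) \<le> onorm (\<lambda>x :: sobolev. x) + ?M"
      by (rule onorm_triangle[OF bounded_linear_ident T])
    also have "onorm (\<lambda>x :: sobolev. x) \<le> 1" by (rule onorm_id_le)
    finally show "onorm (\<lambda>x. x + T x) \<le> 1 + ?M" by simp
  next
    show "1 + ?M \<le> onorm (\<lambda>x. x + T x)"
    proof (rule field_le_epsilon)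
      fix \<epsilon> :: real assume \<epsilon>: "\<epsilon> > 0"
      \<comment> \<open>Half of \<open>\<epsilon>\<close> pays for the slice, the other half for the defect of orthogonality, which
        is scaled by \<open>\<bar>\<xi> y\<bar> \<le> onorm T\<close>.  The maximum keeps \<open>K\<close> nonnegative, so that a pointwise
        bound of \<open>T\<close> by \<open>K\<close> is one of its operator norm.\<close>
      define K where "K = max 0 (?M - \<epsilon> / 2)"
      define \<eta> where "\<eta> = \<epsilon> / (2 * ?M)"
      have \<eta>: "\<eta> > 0" using \<epsilon> Mpos by (simp add: \<eta>_def)
      have "\<exists>x. \<xi> x > K * norm x"
      proof (rule ccontr)
        assume "\<not> ?thesis"
        then have le: "\<xi> x \<le> K * norm x" for x by (meson not_le)
        have "?M \<le> K"
        proof (rule onorm_bound)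
          show "norm (T x) \<le> K * norm x" for x
            using le[of x] le[of "- x"] by (simp add: \<xi>_norm linear_neg[OF lin] abs_le_iff)
        qed (simp add: K_def)
        then show False using \<epsilon> Mpos by (simp add: K_def)
      qed
      then obtain x where x: "\<xi> x > K * norm x" by blast
      obtain y where y: "norm y = 1" "\<xi> y > K"
        and orth: "\<And>a. norm (y + a *\<^sub>R e) \<ge> 1 + \<bar>a\<bar> * (norm e - \<eta>)"
        using slice_almost_l1_orthogonal[OF lin M x \<eta>, where w=e] by blast
      have "\<bar>\<xi> y\<bar> * \<eta> \<le> ?M * \<eta>"
        using M[of y] y(1) \<eta> by (intro mult_right_mono) auto
      also have "\<dots> = \<epsilon> / 2" using Mpos by (simp add: \<eta>_def)
      finally have "1 + ?M - \<epsilon> \<le> 1 + \<bar>\<xi> y\<bar> * (norm e - \<eta>)"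
        using y(2) e by (simp add: K_def right_diff_distrib)
      also have "\<dots> \<le> norm (y + T y)" unfolding T_eq by (rule orth)
      also have "\<dots> \<le> onorm (\<lambda>x. x + T x)" using onorm[OF IT, of y] y(1) by simp
      finally show "1 + ?M \<le> onorm (\<lambda>x. x + T x) + \<epsilon>" by simp
    qed
  qed
qed

end
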